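(* Let $\mathcal{H}$ be a finite-dimensional complex Hilbert space. Let $\Theta,\Lambda\in H^{\infty}(L(\mathcal{H}))$ be two inner functions and let $J$ be a conjugation in $\mathcal{H}$. There exists a conjugation $\mathbf{C}$ in $L^2(\mathcal{H})$ with $\mathbf{C}\mathbf{M}_z=\mathbf{M}_z\mathbf{C}$ such that $\mathbf{C}(\Lambda H^2(\mathcal{H}))\subset\Theta H^2(\mathcal{H})$ if and only if there is an inner function $\Psi\in H^{\infty}(L(\mathcal{H}))$ such that $$(\Psi\Lambda^{*}\Theta)_J=(\Psi\Lambda^{*}\Theta)^{*}.$$ In that case, $\mathbf{C}=\mathbf{C}_J^{\Lambda,\Gamma}$ for some inner function $\Gamma\in H^{\infty}(L(\mathcal{H}))$ such that $\Theta\leqslant\Gamma$ and $$\Gamma\Lambda_J^{*}=\Lambda\Gamma_J^{*}.$$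
   Context: $\mathbb{T}$ is the unit circle with normalized Lebesgue measure. A conjugation on a Hilbert space $\mathcal{K}$ is an antilinear map $C$ with $C^2=I$ and $\langle Cf,Cg\rangle=\langle g,f\rangle$. $L^2(\mathcal{H})$ is the Hilbert space of measurable square-integrable functions $\mathbb{T}\to\mathcal{H}$; $H^2(\mathcal{H})$ is its subspace of functions whose Fourier coefficients of negative index vanish. $L^\infty(L(\mathcal{H}))$ is the space of essentially bounded measurable functions $\mathbb{T}\to L(\mathcal{H})$ ($L(\mathcal{H})$ = bounded linear operators), and $H^\infty(L(\mathcal{H}))$ its subspace of functions with vanishing negative Fourier coefficients. For $\mathbf{F}\in L^\infty(L(\mathcal{H}))$: $(M_{\mathbf{F}}\mathbf{f})(z)=\mathbf{F}(z)\mathbf{f}(z)$, $\mathbf{F}^*(z)=\mathbf{F}(z)^*$, $\mathbf{F}_J(z)=J\mathbf{F}(\bar z)J$ a.e. on $\mathbb{T}$, and $\mathbf{F}_J^*=(\mathbf{F}_J)^*$; products of operator valued functions are pointwise. $(\mathbf{M}_z\mathbf{f})(z)=z\mathbf{f}(z)$. An inner function is $\Theta\in H^\infty(L(\mathcal{H}))$ with $\Theta(z)$ unitary for almost all $z\in\mathbb{T}$. For inner functions, $\Theta\leqslant\Gamma$ means $\Theta^*\Gamma\in H^\infty(L(\mathcal{H}))$. $\mathbf{J}^\star$ is the conjugation on $L^2(\mathcal{H})$ given by $(\mathbf{J}^\star\mathbf{f})(z)=J(\mathbf{f}(\bar z))$ a.e., and for inner $\Lambda,\Gamma$, $\mathbf{C}_J^{\Lambda,\Gamma}=M_{\Gamma}\mathbf{J}^{\star}M_{\Lambda^*}$.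 *)

theory Defs
  imports "HOL-Analysis.Analysis"
begin

section \<open>Finite-dimensional complex Hilbert spaces\<close>

class complex_inner = real_inner +
  fixes scaleC :: "complex \<Rightarrow> 'a \<Rightarrow> 'a"  (infixr "*\<^sub>C" 75)
    and cinner :: "'a \<Rightarrow> 'a \<Rightarrow> complex"
  assumes scaleC_add_right: "a *\<^sub>C (x + y) = a *\<^sub>C x + a *\<^sub>C y"
    and scaleC_add_left: "(a + b) *\<^sub>C x = a *\<^sub>C x + b *\<^sub>C x"
    and scaleC_scaleC: "a *\<^sub>C (b *\<^sub>C x) = (a * b) *\<^sub>C x"
    and scaleR_scaleC: "r *\<^sub>R x = complex_of_real r *\<^sub>C x"
    and cinner_commute: "cinner x y = cnj (cinner y x)"
    and cinner_add_left: "cinner (x + y) z = cinner x z + cinner y z"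
    and cinner_scaleC_left: "cinner (a *\<^sub>C x) y = a * cinner x y"
    \<comment> \<open>Positive definiteness and the norm \<open>sqrt (cinner x x)\<close> follow from this link with the
        real inner product.\<close>
    and inner_eq_Re_cinner: "inner x y = Re (cinner x y)"

text \<open>
  Completeness and second countability are automatic in finite dimension; they are listed as
  superclasses only so that the library's Bochner integral applies.  Dimension zero is allowed.
\<close>
class findim_chilbert = complex_inner + complete_space + second_countable_topology +
  assumes finite_dimensional: "\<exists>B. finite B \<and> (\<forall>x. \<exists>c. x = (\<Sum>b\<in>B. c b *\<^sub>C b))"
begin

subclass banach ..

end

instantiation complex :: findim_chilbert
begin

definition scaleC_complex :: "complex \<Rightarrow> complex \<Rightarrow> complex"
  where "scaleC_complex a x = a * x"

definition cinner_complex :: "complex \<Rightarrow> complex \<Rightarrow> complex"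
  where "cinner_complex x y = x * cnj y"

instance
proof
  show "\<exists>B::complex set. finite B \<and> (\<forall>x. \<exists>c. x = (\<Sum>b\<in>B. c b *\<^sub>C b))"
    by (rule exI[of _ "{1}"]) (auto simp: scaleC_complex_def)
qed (auto simp: scaleC_complex_def cinner_complex_def algebra_simps scaleR_conv_of_real
       inner_complex_def)

end

instantiation vec :: (complex_inner, finite) complex_inner
begin

definition scaleC_vec :: "complex \<Rightarrow> 'a ^ 'b \<Rightarrow> 'a ^ 'b"
  where "scaleC_vec a x = (\<chi> i. a *\<^sub>C x $ i)"

definition cinner_vec :: "'a ^ 'b \<Rightarrow> 'a ^ 'b \<Rightarrow> complex"
  where "cinner_vec x y = (\<Sum>i\<in>UNIV. cinner (x $ i) (y $ i))"

instance
proof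
  fix x y :: "'a ^ 'b"
  show "cinner x y = cnj (cinner y x)"
    unfolding cinner_vec_def cnj_sum by (rule sum.cong[OF refl]) (rule cinner_commute)
qed (simp_all add: scaleC_vec_def cinner_vec_def vec_eq_iff scaleC_add_right scaleC_add_left
      scaleC_scaleC scaleR_scaleC cinner_add_left cinner_scaleC_left sum.distrib
      sum_distrib_left inner_vec_def inner_eq_Re_cinner)

end

instance vec :: ("{findim_chilbert, euclidean_space}", finite) findim_chilbert
proof
  obtain B :: "'a set" where B: "finite B" "\<And>x. \<exists>c. x = (\<Sum>b\<in>B. c b *\<^sub>C b)"
    using finite_dimensional by blast
  have zero: "a *\<^sub>C (0::'a) = 0" for a
    using scaleC_add_right[of a "0::'a" 0] by simp
  define A where "A = (\<lambda>(i::'b, b::'a). axis i b) ` (UNIV \<times> (B - {0}))"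
  have inj: "inj_on (\<lambda>(i::'b, b::'a). axis i b) (UNIV \<times> (B - {0}))"
    by (auto simp: inj_on_def axis_eq_axis)
  have "\<exists>c. x = (\<Sum>v\<in>A. c v *\<^sub>C v)" for x :: "'a ^ 'b"
  proof -
    obtain k where k: "\<And>i. x $ i = (\<Sum>b\<in>B. k i b *\<^sub>C b)"
      using choice[of "\<lambda>i c. x $ i = (\<Sum>b\<in>B. c b *\<^sub>C b)"] B(2) by blast
    define c where "c v = (case inv_into (UNIV \<times> (B - {0})) (\<lambda>(i, b). axis i b) v of (i, b) \<Rightarrow> k i b)"
      for v
    have c: "c (axis i b) = k i b" if "b \<in> B - {0}" for i b
      using inv_into_f_f[OF inj, of "(i, b)"] that by (simp add: c_def)
    have "(\<Sum>v\<in>A. c v *\<^sub>C v) $ j = x $ j" for j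
    proof -
      have "(\<Sum>v\<in>A. c v *\<^sub>C v) = (\<Sum>(i, b)\<in>UNIV \<times> (B - {0}). c (axis i b) *\<^sub>C axis i b)"
        unfolding A_def by (subst sum.reindex[OF inj]) (simp add: case_prod_unfold)
      also have "\<dots> = (\<Sum>i\<in>UNIV. \<Sum>b\<in>B - {0}. c (axis i b) *\<^sub>C axis i b)"
        by (simp only: sum.cartesian_product)
      also have "\<dots> = (\<Sum>i\<in>UNIV. \<Sum>b\<in>B - {0}. k i b *\<^sub>C axis i b)"
        by (intro sum.cong refl) (simp add: c)
      also have "\<dots> $ j = (\<Sum>i\<in>UNIV. \<Sum>b\<in>B - {0}. if i = j then k i b *\<^sub>C b else 0)"
        unfolding sum_component
        by (intro sum.cong refl) (simp add: scaleC_vec_def axis_def zero)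
      also have "\<dots> = (\<Sum>i\<in>UNIV. if i = j then \<Sum>b\<in>B - {0}. k i b *\<^sub>C b else 0)"
        by (intro sum.cong) auto
      also have "\<dots> = (\<Sum>b\<in>B - {0}. k j b *\<^sub>C b)"
        by simp
      also have "\<dots> = (\<Sum>b\<in>B. k j b *\<^sub>C b)"
        by (rule sum.mono_neutral_left) (auto simp: B(1) zero)
      finally show ?thesis by (simp only: k)
    qed
    then show ?thesis by (intro exI[of _ c]) (simp add: vec_eq_iff)
  qed
  moreover have "finite A" using B(1) by (simp add: A_def)
  ultimately show "\<exists>B. finite B \<and> (\<forall>x::'a ^ 'b. \<exists>c. x = (\<Sum>b\<in>B. c b *\<^sub>C b))" by blast
qed

definition bounded_clinear :: "('h::complex_inner \<Rightarrow> 'h) \<Rightarrow> bool" where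
  "bounded_clinear A \<longleftrightarrow> bounded_linear A \<and> (\<forall>c x. A (c *\<^sub>C x) = c *\<^sub>C A x)"

definition cadjoint :: "('h::complex_inner \<Rightarrow> 'h) \<Rightarrow> 'h \<Rightarrow> 'h" where
  "cadjoint A = (SOME B. \<forall>x y. cinner (A x) y = cinner x (B y))"

definition unitary_op :: "('h::complex_inner \<Rightarrow> 'h) \<Rightarrow> bool" where
  "unitary_op A \<longleftrightarrow> bounded_clinear A \<and> cadjoint A \<circ> A = id \<and> A \<circ> cadjoint A = id"

definition conjugation :: "('h::complex_inner \<Rightarrow> 'h) \<Rightarrow> bool" where
  "conjugation J \<longleftrightarrow>
     (\<forall>x y. J (x + y) = J x + J y) \<and>
     (\<forall>c x. J (c *\<^sub>C x) = cnj c *\<^sub>C J x) \<and>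
     (\<forall>x. J (J x) = x) \<and>
     (\<forall>x y. cinner (J x) (J y) = cinner y x)"


section \<open>Vector-valued functions on the unit circle\<close>

definition circle_measure :: "complex measure" where
  "circle_measure =
     distr (uniform_measure lborel {0..<2 * pi}) (restrict_space borel (sphere 0 1)) cis"

text \<open>
  Elements of \<open>L\<^sup>2\<close> are represented by functions on the circle, identified when they agree
  almost everywhere.  The type also records values off the circle; these are irrelevant, because
  the space of \<open>circle_measure\<close> is the circle itself.
\<close>
definition ae_eq :: "(complex \<Rightarrow> 'b) \<Rightarrow> (complex \<Rightarrow> 'b) \<Rightarrow> bool" where
  "ae_eq f g \<longleftrightarrow> (AE z in circle_measure. f z = g z)"

definition L2 :: "(complex \<Rightarrow> 'h::findim_chilbert) set" where
  "L2 = {f \<in> borel_measurable circle_measure. integrable circle_measure (\<lambda>z. (norm (f z))\<^sup>2)}"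

definition L2_inner :: "(complex \<Rightarrow> 'h::findim_chilbert) \<Rightarrow> (complex \<Rightarrow> 'h) \<Rightarrow> complex" where
  "L2_inner f g = (\<integral>z. cinner (f z) (g z) \<partial>circle_measure)"

definition fourier_coeff :: "(complex \<Rightarrow> 'h::findim_chilbert) \<Rightarrow> int \<Rightarrow> 'h" where
  "fourier_coeff f n = (\<integral>z. (z powi (- n)) *\<^sub>C f z \<partial>circle_measure)"

definition H2 :: "(complex \<Rightarrow> 'h::findim_chilbert) set" where
  "H2 = {f \<in> L2. \<forall>n<0. fourier_coeff f n = 0}"

text \<open>
  A map on representatives describes a conjugation on \<open>L\<^sup>2\<close> if it respects equality almost
  everywhere and the induced map on classes is antilinear, involutive and isometric.
\<close>
definition L2_conjugation ::
  "((complex \<Rightarrow> 'h::findim_chilbert) \<Rightarrow> (complex \<Rightarrow> 'h)) \<Rightarrow> bool" where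
  "L2_conjugation C \<longleftrightarrow>
     (\<forall>f\<in>L2. C f \<in> L2) \<and>
     (\<forall>f\<in>L2. \<forall>g\<in>L2. ae_eq f g \<longrightarrow> ae_eq (C f) (C g)) \<and>
     (\<forall>f\<in>L2. \<forall>g\<in>L2. ae_eq (C (\<lambda>z. f z + g z)) (\<lambda>z. C f z + C g z)) \<and>
     (\<forall>c. \<forall>f\<in>L2. ae_eq (C (\<lambda>z. c *\<^sub>C f z)) (\<lambda>z. cnj c *\<^sub>C C f z)) \<and>
     (\<forall>f\<in>L2. ae_eq (C (C f)) f) \<and>
     (\<forall>f\<in>L2. \<forall>g\<in>L2. L2_inner (C f) (C g) = L2_inner g f)"

definition shift_op :: "(complex \<Rightarrow> 'h::complex_inner) \<Rightarrow> complex \<Rightarrow> 'h" where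
  "shift_op f z = z *\<^sub>C f z"


section \<open>Operator-valued functions on the unit circle\<close>

text \<open>
  As \<open>'h\<close> is finite-dimensional, measurability in the operator norm is the same as measurability
  of all the functions \<open>\<lambda>z. F z x\<close>.
\<close>
definition Linf_op :: "(complex \<Rightarrow> 'h::findim_chilbert \<Rightarrow> 'h) set" where
  "Linf_op = {F. (\<forall>z\<in>sphere 0 1. bounded_clinear (F z)) \<and>
                 (\<forall>x. (\<lambda>z. F z x) \<in> borel_measurable circle_measure) \<and>
                 (\<exists>c. AE z in circle_measure. onorm (F z) \<le> c)}"

definition fourier_coeff_op :: "(complex \<Rightarrow> 'h::findim_chilbert \<Rightarrow> 'h) \<Rightarrow> int \<Rightarrow> 'h \<Rightarrow> 'h" where
  "fourier_coeff_op F n = (\<lambda>x. fourier_coeff (\<lambda>z. F z x) n)"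

definition Hinf_op :: "(complex \<Rightarrow> 'h::findim_chilbert \<Rightarrow> 'h) set" where
  "Hinf_op = {F \<in> Linf_op. \<forall>n<0. fourier_coeff_op F n = (\<lambda>x. 0)}"

definition mult_op :: "(complex \<Rightarrow> 'h \<Rightarrow> 'h) \<Rightarrow> (complex \<Rightarrow> 'h) \<Rightarrow> complex \<Rightarrow> 'h" where
  "mult_op F f z = F z (f z)"

definition prod_op :: "(complex \<Rightarrow> 'h \<Rightarrow> 'h) \<Rightarrow> (complex \<Rightarrow> 'h \<Rightarrow> 'h) \<Rightarrow> complex \<Rightarrow> 'h \<Rightarrow> 'h"
    (infixl "\<odot>" 70) where
  "(F \<odot> G) z = F z \<circ> G z"

definition adj_op :: "(complex \<Rightarrow> 'h::complex_inner \<Rightarrow> 'h) \<Rightarrow> complex \<Rightarrow> 'h \<Rightarrow> 'h" where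
  "adj_op F z = cadjoint (F z)"

definition conj_op :: "('h \<Rightarrow> 'h) \<Rightarrow> (complex \<Rightarrow> 'h \<Rightarrow> 'h) \<Rightarrow> complex \<Rightarrow> 'h \<Rightarrow> 'h" where
  "conj_op J F z = J \<circ> F (cnj z) \<circ> J"

definition inner_function :: "(complex \<Rightarrow> 'h::findim_chilbert \<Rightarrow> 'h) \<Rightarrow> bool" where
  "inner_function F \<longleftrightarrow> F \<in> Hinf_op \<and> (AE z in circle_measure. unitary_op (F z))"

definition inner_le :: "(complex \<Rightarrow> 'h::findim_chilbert \<Rightarrow> 'h) \<Rightarrow> (complex \<Rightarrow> 'h \<Rightarrow> 'h) \<Rightarrow> bool" where
  "inner_le F G \<longleftrightarrow> adj_op F \<odot> G \<in> Hinf_op"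

text \<open>All representatives of the elements of \<open>F H\<^sup>2\<close>.\<close>
definition mult_H2 :: "(complex \<Rightarrow> 'h::findim_chilbert \<Rightarrow> 'h) \<Rightarrow> (complex \<Rightarrow> 'h) set" where
  "mult_H2 F = {g \<in> L2. \<exists>h\<in>H2. ae_eq g (mult_op F h)}"

definition J_star :: "('h \<Rightarrow> 'h) \<Rightarrow> (complex \<Rightarrow> 'h) \<Rightarrow> complex \<Rightarrow> 'h" where
  "J_star J f z = J (f (cnj z))"

definition C_J ::
  "('h::complex_inner \<Rightarrow> 'h) \<Rightarrow> (complex \<Rightarrow> 'h \<Rightarrow> 'h) \<Rightarrow> (complex \<Rightarrow> 'h \<Rightarrow> 'h)
     \<Rightarrow> (complex \<Rightarrow> 'h) \<Rightarrow> complex \<Rightarrow> 'h" where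
  "C_J J \<Lambda> \<Gamma> = mult_op \<Gamma> \<circ> J_star J \<circ> mult_op (adj_op \<Lambda>)"

text \<open>The conjugations considered: those commuting with the shift and mapping \<open>\<Lambda> H\<^sup>2\<close> into
  \<open>\<Theta> H\<^sup>2\<close>.\<close>
definition shift_conjugation_into ::
  "(complex \<Rightarrow> 'h::findim_chilbert \<Rightarrow> 'h) \<Rightarrow> (complex \<Rightarrow> 'h \<Rightarrow> 'h)
     \<Rightarrow> ((complex \<Rightarrow> 'h) \<Rightarrow> (complex \<Rightarrow> 'h)) \<Rightarrow> bool" where
  "shift_conjugation_into \<Lambda> \<Theta> C \<longleftrightarrow>
     L2_conjugation C \<and>
     (\<forall>f\<in>L2. ae_eq (C (shift_op f)) (shift_op (C f))) \<and>
     C ` mult_H2 \<Lambda> \<subseteq> mult_H2 \<Theta>"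

end

theory Submission
  imports Defs
begin

text \<open>
  An antilinear operator that commutes with the shift is determined by an operator-valued symbol.
  Since \<open>J\<^sup>\<star>\<close> is antilinear and commutes with the shift, a conjugation \<open>C\<close> that commutes with the shift
  has the form \<open>M\<^bsub>G\<^esub> J\<^sup>\<star>\<close> with \<open>G\<close> unitary-valued.  As \<open>J\<^sup>\<star> \<Lambda> = \<Lambda>\<^sub>J J\<^sup>\<star>\<close> and \<open>J\<^sup>\<star>\<close>
  preserves \<open>H\<^sup>2\<close>, the inclusion \<open>C (\<Lambda> H\<^sup>2) \<subseteq> \<Theta> H\<^sup>2\<close> says that \<open>\<Gamma> = G \<Lambda>\<^sub>J\<close> maps \<open>H\<^sup>2\<close> into
  \<open>\<Theta> H\<^sup>2\<close>, that is, \<open>\<Gamma>\<close> is inner and \<open>\<Theta> \<le> \<Gamma>\<close>.  Then \<open>C = \<Gamma> J\<^sup>\<star> \<Lambda>\<^sup>*\<close>, and \<open>C\<^sup>2 = 1\<close> is the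
  equation \<open>\<Gamma> \<Lambda>\<^sub>J\<^sup>* = \<Lambda> \<Gamma>\<^sub>J\<^sup>*\<close>.  Writing \<open>\<Gamma> = \<Theta> \<Psi>\<^sub>J\<close> turns this equation into
  \<open>(\<Psi> \<Lambda>\<^sup>* \<Theta>)\<^sub>J = (\<Psi> \<Lambda>\<^sup>* \<Theta>)\<^sup>*\<close>, and every step can be reversed.  The lemmas
  \<open>shift_conjugation_symbol\<close>, \<open>conj_eq_adj_from_symbol\<close> and \<open>shift_conjugation_from_inner\<close>
  carry this out; \<open>\<Gamma>\<close> is constructed directly from its columns \<open>C (\<Lambda> J e)\<close>, without passing
  through \<open>G\<close>.

  The analytic content is in three facts about scalar functions on the circle: integrable
  functions are determined by their Fourier coefficients (\<open>fourier_uniqueness\<close>), the measure is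
  invariant under reflection (\<open>distr_cnj\<close>), and the product of a function in \<open>H\<^sup>2\<close> with one in
  \<open>H\<^sup>\<infinity>\<close> has vanishing negative Fourier coefficients (\<open>hardy_product\<close>).  All three are instances of one
  functional monotone class theorem, the locale \<open>circle_function_class\<close>: each is clear for the
  monomials \<open>z\<^sup>n\<close>, or reduces to a property that is, and this property passes to linear combinations
  and bounded pointwise limits, hence to all bounded Borel functions.
\<close>


section \<open>Linear algebra in a finite-dimensional complex inner product space\<close>

lemma scaleC_zero_right [simp]: "c *\<^sub>C (0::'a::complex_inner) = 0"
  using scaleC_add_right[of c "0::'a" 0] by simp

lemma scaleC_zero_left [simp]: "0 *\<^sub>C (x::'a::complex_inner) = 0"
  using scaleC_add_left[of 0 0 x] by simp

lemma scaleC_one [simp]: "1 *\<^sub>C (x::'a::complex_inner) = x"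
  using scaleR_scaleC[of 1 x] by simp

lemma scaleC_sum_right: "c *\<^sub>C (\<Sum>i\<in>I. f i :: 'a::complex_inner) = (\<Sum>i\<in>I. c *\<^sub>C f i)"
  by (induction I rule: infinite_finite_induct) (auto simp: scaleC_add_right)

lemma cinner_zero_left [simp]: "cinner 0 (x::'a::complex_inner) = 0"
  using cinner_add_left[of 0 0 x] by simp

lemma cnj_cinner [simp]: "cnj (cinner x y) = cinner y (x::'a::complex_inner)"
  by (rule cinner_commute[symmetric])

lemma cinner_zero_right [simp]: "cinner (x::'a::complex_inner) 0 = 0"
  using cinner_commute[of x 0] by simp

lemma cmod_cinner_commute: "cmod (cinner x y) = cmod (cinner y (x::'a::complex_inner))"
  by (metis cnj_cinner complex_mod_cnj)

lemma cinner_add_right: "cinner x (y + z) = cinner x y + cinner (x::'a::complex_inner) z"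
proof -
  have "cnj (cinner (y + z) x) = cnj (cinner y x) + cnj (cinner z x)"
    by (simp only: cinner_add_left complex_cnj_add)
  then show ?thesis by (simp only: cnj_cinner)
qed

lemma cinner_scaleC_right: "cinner x (c *\<^sub>C y) = cnj c * cinner (x::'a::complex_inner) y"
proof -
  have "cnj (cinner (c *\<^sub>C y) x) = cnj c * cnj (cinner y x)"
    by (simp only: cinner_scaleC_left complex_cnj_mult)
  then show ?thesis by (simp only: cnj_cinner)
qed

lemma scaleC_minus1: "(- 1) *\<^sub>C (x::'a::complex_inner) = - x"
  using scaleC_add_left[of 1 "-1" x] by (simp add: add_eq_0_iff)

lemma cinner_minus_left: "cinner (- x) (y::'a::complex_inner) = - cinner x y"
  using cinner_scaleC_left[of "-1" x y] by (simp add: scaleC_minus1)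

lemma cinner_diff_left: "cinner (x - y) (z::'a::complex_inner) = cinner x z - cinner y z"
  using cinner_add_left[of x "- y" z] by (simp add: cinner_minus_left)

lemma cinner_sum_left: "cinner (\<Sum>i\<in>I. f i) (y::'a::complex_inner) = (\<Sum>i\<in>I. cinner (f i) y)"
  by (induction I rule: infinite_finite_induct) (auto simp: cinner_add_left)

lemma cinner_sum_right: "cinner y (\<Sum>i\<in>I. f i :: 'a::complex_inner) = (\<Sum>i\<in>I. cinner y (f i))"
  by (induction I rule: infinite_finite_induct) (auto simp: cinner_add_right)

lemma cinner_self: "cinner x (x::'a::complex_inner) = complex_of_real ((norm x)\<^sup>2)"
proof (rule complex_eqI)
  show "Re (cinner x x) = Re (complex_of_real ((norm x)\<^sup>2))"
    using inner_eq_Re_cinner[of x x] by (simp add: power2_norm_eq_inner)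
  show "Im (cinner x x) = Im (complex_of_real ((norm x)\<^sup>2))"
    using arg_cong[OF cinner_commute[of x x], of Im] by (simp del: cnj_cinner)
qed

lemma norm_scaleC: "norm (c *\<^sub>C (x::'a::complex_inner)) = cmod c * norm x"
proof -
  have "complex_of_real ((norm (c *\<^sub>C x))\<^sup>2) = (c * cnj c) * cinner x x"
    by (simp only: cinner_self[symmetric] cinner_scaleC_left cinner_scaleC_right ac_simps)
  also have "\<dots> = complex_of_real ((cmod c * norm x)\<^sup>2)"
    by (simp only: complex_norm_square[symmetric] cinner_self of_real_mult power_mult_distrib)
  finally have "(norm (c *\<^sub>C x))\<^sup>2 = (cmod c * norm x)\<^sup>2"
    using of_real_eq_iff by blast
  then show ?thesis by (simp add: power2_eq_iff_nonneg)
qed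

lemma cinner_norm_le: "cmod (cinner x (y::'a::complex_inner)) \<le> norm x * norm y"
proof (cases "cinner x y = 0")
  case False
  \<comment> \<open>Rotating \<open>x\<close> makes the inner product real, which reduces the claim to the real inequality.\<close>
  define u where "u = cnj (sgn (cinner x y))"
  have u: "cmod u = 1" using False by (simp add: u_def norm_sgn)
  have "cinner (u *\<^sub>C x) y = cnj (sgn (cinner x y)) * cinner x y"
    by (simp add: u_def cinner_scaleC_left)
  also have "\<dots> = (cinner x y * cnj (cinner x y)) / cmod (cinner x y)"
    by (simp add: sgn_eq mult.commute del: cnj_cinner)
  also have "\<dots> = complex_of_real (cmod (cinner x y))"
    using False by (simp add: complex_norm_square[symmetric] power2_eq_square del: cnj_cinner)
  finally have "complex_of_real (cmod (cinner x y)) = cinner (u *\<^sub>C x) y" by simp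
  then have "cmod (cinner x y) = inner (u *\<^sub>C x) y"
    by (metis Re_complex_of_real inner_eq_Re_cinner)
  also have "\<dots> \<le> norm (u *\<^sub>C x) * norm y" by (rule norm_cauchy_schwarz)
  finally show ?thesis by (simp add: norm_scaleC u)
qed auto

lemma bounded_bilinear_scaleC: "bounded_bilinear (\<lambda>c (x::'a::complex_inner). c *\<^sub>C x)"
proof
  show "\<exists>K. \<forall>a b. norm (a *\<^sub>C (b::'a)) \<le> norm a * norm b * K"
    by (rule exI[of _ 1]) (simp add: norm_scaleC)
qed (simp_all add: scaleC_add_left scaleC_add_right scaleR_scaleC[where 'a='a] scaleC_scaleC
       scaleR_conv_of_real mult.commute)

lemma bounded_bilinear_cinner: "bounded_bilinear (\<lambda>x (y::'a::complex_inner). cinner x y)"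
proof
  show "\<exists>K. \<forall>a b. norm (cinner (a::'a) b) \<le> norm a * norm b * K"
    by (rule exI[of _ 1]) (simp add: cinner_norm_le)
qed (simp_all add: cinner_add_left cinner_add_right scaleR_scaleC[where 'a='a] cinner_scaleC_left
       cinner_scaleC_right scaleR_conv_of_real)

lemma cinner_extensionality:
  assumes "\<And>z. cinner x z = cinner y (z::'a::complex_inner)"
  shows "x = y"
  using assms[of "x - y"] cinner_self[of "x - y"] by (simp add: cinner_diff_left)

lemma cinner_polarise:
  "(norm (x - y))\<^sup>2 = (norm x)\<^sup>2 + (norm (y::'a::complex_inner))\<^sup>2 - 2 * Re (cinner x y)"
  by (simp add: power2_norm_eq_inner inner_diff_left inner_diff_right inner_commute
      inner_eq_Re_cinner[symmetric])

definition orthonormal :: "'a::complex_inner set \<Rightarrow> bool" where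
  "orthonormal E \<longleftrightarrow> (\<forall>x\<in>E. \<forall>y\<in>E. cinner x y = (if x = y then 1 else 0))"

definition in_cspan :: "'a::complex_inner set \<Rightarrow> 'a \<Rightarrow> bool" where
  "in_cspan B x \<longleftrightarrow> (\<exists>c. x = (\<Sum>b\<in>B. c b *\<^sub>C b))"

lemma orthonormal_expansion:
  assumes "finite E" "orthonormal E" "in_cspan E x"
  shows "x = (\<Sum>e\<in>E. cinner x e *\<^sub>C e)"
proof -
  obtain c where c: "x = (\<Sum>b\<in>E. c b *\<^sub>C b)" using assms(3) by (auto simp: in_cspan_def)
  have "cinner x e = c e" if "e \<in> E" for e
  proof -
    have "cinner x e = (\<Sum>b\<in>E. c b * (if b = e then 1 else 0))"
      unfolding c cinner_sum_left cinner_scaleC_left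
      using assms(2) that by (intro sum.cong) (auto simp: orthonormal_def)
    also have "\<dots> = (\<Sum>b\<in>E. if b = e then c b else 0)" by (intro sum.cong) auto
    also have "\<dots> = c e" using that assms(1) by simp
    finally show ?thesis .
  qed
  then show ?thesis using c by simp
qed

text \<open>
  Gram--Schmidt: the component \<open>r\<close> of the new vector that is orthogonal to the vectors found so
  far is normalised and added, unless it vanishes.
\<close>
lemma orthonormal_spanning_exists:
  assumes "finite B"
  shows "\<exists>E. finite E \<and> orthonormal E \<and> (\<forall>x. in_cspan B x \<longrightarrow> in_cspan E x)"
  using assms
proof (induction B)
  case empty
  show ?case by (rule exI[of _ "{}"]) (auto simp: orthonormal_def)
next
  case (insert b B)
  then obtain E where E: "finite E" "orthonormal E" "\<And>x. in_cspan B x \<Longrightarrow> in_cspan E x" by blast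
  define r where "r = b - (\<Sum>e\<in>E. cinner b e *\<^sub>C e)"
  have r: "cinner r e = 0" if "e \<in> E" for e
  proof -
    have "(\<Sum>f\<in>E. cinner b f * cinner f e) = (\<Sum>f\<in>E. if f = e then cinner b f else 0)"
      using E(2) that by (intro sum.cong) (auto simp: orthonormal_def)
    then show ?thesis
      using that E(1) by (simp add: r_def cinner_diff_left cinner_sum_left cinner_scaleC_left)
  qed
  have split: "\<exists>k d. x = k *\<^sub>C r + (\<Sum>e\<in>E. d e *\<^sub>C e)" if "in_cspan (insert b B) x" for x
  proof -
    obtain c where c: "x = (\<Sum>v\<in>insert b B. c v *\<^sub>C v)" using \<open>in_cspan (insert b B) x\<close>
      by (auto simp: in_cspan_def)
    obtain d where d: "(\<Sum>v\<in>B. c v *\<^sub>C v) = (\<Sum>e\<in>E. d e *\<^sub>C e)"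
      using E(3) by (auto simp: in_cspan_def)
    have "b = r + (\<Sum>e\<in>E. cinner b e *\<^sub>C e)" by (simp add: r_def)
    then have "c b *\<^sub>C b = c b *\<^sub>C r + (\<Sum>e\<in>E. (c b * cinner b e) *\<^sub>C e)"
      by (metis (no_types, lifting) scaleC_add_right scaleC_scaleC scaleC_sum_right sum.cong)
    then have "x = c b *\<^sub>C r + (\<Sum>e\<in>E. (c b * cinner b e + d e) *\<^sub>C e)"
      using c insert.hyps by (simp add: d scaleC_add_left sum.distrib)
    then show ?thesis by (intro exI[of _ "c b"] exI[of _ "\<lambda>e. c b * cinner b e + d e"])
  qed
  show ?case
  proof (cases "r = 0")
    case True
    have "in_cspan E x" if "in_cspan (insert b B) x" for x
      using split[OF that] True by (auto simp: in_cspan_def)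
    then show ?thesis using E by blast
  next
    case False
    define u where "u = complex_of_real (inverse (norm r)) *\<^sub>C r"
    have ru: "r = complex_of_real (norm r) *\<^sub>C u"
      using False by (simp add: u_def scaleC_scaleC)
    have uu: "cinner u u = 1"
      using False by (simp add: cinner_self u_def norm_scaleC norm_inverse)
    have ue: "cinner u e = 0" "cinner e u = 0" if "e \<in> E" for e
      using r[OF that] cinner_commute[of e u] by (simp_all add: u_def cinner_scaleC_left)
    have uE: "u \<notin> E" using ue(1)[of u] uu by auto
    have "in_cspan (insert u E) x" if x: "in_cspan (insert b B) x" for x
    proof -
      obtain k d where kd: "x = k *\<^sub>C r + (\<Sum>e\<in>E. d e *\<^sub>C e)" using split[OF x] by blast
      have "(\<Sum>e\<in>E. d e *\<^sub>C e) = (\<Sum>e\<in>E. (d(u := k * norm r)) e *\<^sub>C e)"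
        using uE by (intro sum.cong) auto
      moreover have "k *\<^sub>C r = (k * norm r) *\<^sub>C u"
        by (subst ru) (simp add: scaleC_scaleC)
      ultimately have "x = (\<Sum>e\<in>insert u E. (d(u := k * norm r)) e *\<^sub>C e)"
        using kd uE E(1) by simp
      then show ?thesis unfolding in_cspan_def by blast
    qed
    moreover have "orthonormal (insert u E)"
      using E(2) uu ue uE by (auto simp: orthonormal_def)
    ultimately show ?thesis using E(1) by (intro exI[of _ "insert u E"]) auto
  qed
qed

definition onb :: "'h::findim_chilbert set" where
  "onb = (SOME E. finite E \<and> orthonormal E \<and> (\<forall>x. in_cspan E x))"

lemma onb_props: "finite (onb :: 'h::findim_chilbert set)" "orthonormal (onb :: 'h set)"
    "in_cspan onb (x :: 'h)"
proof -
  obtain B :: "'h set" where "finite B" "\<And>x. in_cspan B x"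
    using finite_dimensional by (auto simp: in_cspan_def)
  then have "\<exists>E::'h set. finite E \<and> orthonormal E \<and> (\<forall>x. in_cspan E x)"
    using orthonormal_spanning_exists[of B] by metis
  from someI_ex[OF this] show "finite (onb :: 'h set)" "orthonormal (onb :: 'h set)"
    "in_cspan onb (x :: 'h)" by (auto simp: onb_def)
qed

lemma finite_onb [simp]: "finite (onb :: 'h::findim_chilbert set)"
  by (rule onb_props)

lemma onb_cinner: "e \<in> onb \<Longrightarrow> f \<in> onb \<Longrightarrow> cinner e f = (if e = f then 1 else 0)"
  using onb_props(2) by (auto simp: orthonormal_def)

lemma onb_expansion: "(\<Sum>e\<in>onb. cinner x e *\<^sub>C e) = (x :: 'h::findim_chilbert)"
  using orthonormal_expansion onb_props by metis

lemma onb_parseval: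
  "cinner x y = (\<Sum>e\<in>onb. cinner x e * cinner e (y :: 'h::findim_chilbert))"
proof -
  have "cinner x y = cinner (\<Sum>e\<in>onb. cinner x e *\<^sub>C e) y" by (simp add: onb_expansion)
  then show ?thesis by (simp add: cinner_sum_left cinner_scaleC_left)
qed

lemma onb_norm: "(norm x)\<^sup>2 = (\<Sum>e\<in>onb. (cmod (cinner x (e :: 'h::findim_chilbert)))\<^sup>2)"
proof -
  have "cinner x e * cinner e x = complex_of_real ((cmod (cinner x e))\<^sup>2)" for e
    by (subst cinner_commute[of e x]) (simp only: complex_norm_square)
  then have "complex_of_real ((norm x)\<^sup>2) = (\<Sum>e\<in>onb. complex_of_real ((cmod (cinner x e))\<^sup>2))"
    using onb_parseval[of x x] by (simp only: cinner_self[symmetric])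
  then show ?thesis by (metis of_real_eq_iff of_real_sum)
qed

lemma onb_eqI:
  assumes "\<And>e. e \<in> onb \<Longrightarrow> cinner x e = cinner y (e :: 'h::findim_chilbert)"
  shows "x = y"
proof -
  have "(\<Sum>e\<in>onb. cinner x e *\<^sub>C e) = (\<Sum>e\<in>onb. cinner y e *\<^sub>C e)" using assms by simp
  then show ?thesis by (simp add: onb_expansion)
qed


subsection \<open>Linear maps, adjoints and conjugations\<close>

lemma bounded_clinear_simps:
  assumes "bounded_clinear A"
  shows "A (x + y) = A x + A y" "A (c *\<^sub>C x) = c *\<^sub>C A x" "A 0 = 0" "A (x - y) = A x - A y"
    "A (\<Sum>i\<in>I. f i) = (\<Sum>i\<in>I. A (f i))"
proof -
  interpret bounded_linear A using assms by (simp add: bounded_clinear_def)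
  show "A (x + y) = A x + A y" "A 0 = 0" "A (x - y) = A x - A y"
    "A (\<Sum>i\<in>I. f i) = (\<Sum>i\<in>I. A (f i))" by (simp_all add: add zero diff sum)
  show "A (c *\<^sub>C x) = c *\<^sub>C A x" using assms by (simp add: bounded_clinear_def)
qed

lemma bounded_linear_findim:
  fixes A :: "'h::findim_chilbert \<Rightarrow> 'b::real_normed_vector"
  assumes add: "\<And>x y. A (x + y) = A x + A y" and norm: "\<And>c x. norm (A (c *\<^sub>C x)) = cmod c * norm (A x)"
    and scaleR: "\<And>c x. A (c *\<^sub>R x) = c *\<^sub>R A x"
  shows "bounded_linear A"
proof
  show "\<exists>K. \<forall>x. norm (A x) \<le> norm x * K"
  proof (intro exI allI)
    fix x
    have zero: "A 0 = 0" using add[of 0 0] by simp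
    have sum: "A (\<Sum>i\<in>I. f i) = (\<Sum>i\<in>I. A (f i))" for I :: "'h set" and f
      by (induction I rule: infinite_finite_induct) (auto simp: zero add)
    have "norm (A x) = norm (\<Sum>e\<in>onb. A (cinner x e *\<^sub>C e))"
      by (subst onb_expansion[of x, symmetric]) (simp only: sum)
    also have "\<dots> \<le> (\<Sum>e\<in>onb. norm (A (cinner x e *\<^sub>C e)))" by (rule norm_sum)
    also have "\<dots> \<le> (\<Sum>e\<in>onb. norm x * norm e * norm (A e))"
      by (intro sum_mono) (auto simp: norm intro!: mult_right_mono cinner_norm_le)
    also have "\<dots> = norm x * (\<Sum>e\<in>onb. norm e * norm (A e))"
      by (simp add: sum_distrib_left mult.assoc)
    finally show "norm (A x) \<le> norm x * (\<Sum>e\<in>(onb::'h set). norm e * norm (A e))" .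
  qed
qed (use add scaleR in auto)

lemma bounded_clinearI:
  fixes A :: "'h::findim_chilbert \<Rightarrow> 'h"
  assumes "\<And>x y. A (x + y) = A x + A y" "\<And>c x. A (c *\<^sub>C x) = c *\<^sub>C A x"
  shows "bounded_clinear A"
  unfolding bounded_clinear_def
  using assms by (auto intro!: bounded_linear_findim simp: norm_scaleC scaleR_scaleC)

lemma bounded_clinear_expansion:
  fixes A :: "'h::findim_chilbert \<Rightarrow> 'h"
  assumes "bounded_clinear A"
  shows "A x = (\<Sum>e\<in>onb. cinner x e *\<^sub>C A e)"
  by (subst onb_expansion[of x, symmetric]) (simp only: bounded_clinear_simps[OF assms])

lemma bounded_clinear_ext:
  fixes A :: "'h::findim_chilbert \<Rightarrow> 'h"
  assumes "bounded_clinear A" "bounded_clinear B" "\<And>e. e \<in> onb \<Longrightarrow> A e = B e"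
  shows "A = B"
proof
  fix x
  have "A x = (\<Sum>e\<in>onb. cinner x e *\<^sub>C A e)" by (rule bounded_clinear_expansion[OF assms(1)])
  also have "\<dots> = (\<Sum>e\<in>onb. cinner x e *\<^sub>C B e)" using assms(3) by (intro sum.cong) auto
  also have "\<dots> = B x" by (rule bounded_clinear_expansion[OF assms(2), symmetric])
  finally show "A x = B x" .
qed

lemma bounded_clinear_comp:
  "bounded_clinear A \<Longrightarrow> bounded_clinear B \<Longrightarrow> bounded_clinear (A \<circ> (B :: 'h::findim_chilbert \<Rightarrow> 'h))"
  by (rule bounded_clinearI) (simp_all add: bounded_clinear_simps)

lemma bounded_clinear_id: "bounded_clinear (id :: 'h::findim_chilbert \<Rightarrow> 'h)"
  by (rule bounded_clinearI) simp_all

lemma cadjoint_expansion: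
  fixes A :: "'h::findim_chilbert \<Rightarrow> 'h"
  assumes "bounded_clinear A"
  shows "cadjoint A y = (\<Sum>e\<in>onb. cinner y (A e) *\<^sub>C e)"
    and "cinner (A x) y = cinner x (cadjoint A y)"
proof -
  define B where "B y = (\<Sum>e\<in>onb. cinner y (A e) *\<^sub>C e)" for y
  have "cinner (A x) y = cinner x (B y)" for x y
    unfolding bounded_clinear_expansion[OF assms, of x] B_def cinner_sum_left cinner_sum_right
      cinner_scaleC_left cinner_scaleC_right
    by (simp add: mult.commute)
  then have B: "\<forall>x y. cinner (A x) y = cinner x (B y)" by blast
  then have ca: "\<forall>x y. cinner (A x) y = cinner x (cadjoint A y)"
    unfolding cadjoint_def by (rule someI[where P = "\<lambda>B. \<forall>x y. cinner (A x) y = cinner x (B y)"])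
  then show "cinner (A x) y = cinner x (cadjoint A y)" by blast
  have "cadjoint A y = B y"
    by (rule cinner_extensionality) (metis B ca cinner_commute)
  then show "cadjoint A y = (\<Sum>e\<in>onb. cinner y (A e) *\<^sub>C e)" by (simp add: B_def)
qed

lemmas cinner_cadjoint = cadjoint_expansion(2)

lemma cinner_cadjoint_left:
  fixes A :: "'h::findim_chilbert \<Rightarrow> 'h"
  assumes "bounded_clinear A"
  shows "cinner (cadjoint A x) y = cinner x (A y)"
  by (metis assms cinner_cadjoint cinner_commute)

lemma bounded_clinear_cadjoint:
  fixes A :: "'h::findim_chilbert \<Rightarrow> 'h"
  assumes "bounded_clinear A"
  shows "bounded_clinear (cadjoint A)"
  by (rule bounded_clinearI)
    (simp_all add: cadjoint_expansion(1)[OF assms] cinner_add_left cinner_scaleC_left scaleC_add_left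
      sum.distrib scaleC_sum_right scaleC_scaleC)

lemma cadjointI:
  fixes A :: "'h::findim_chilbert \<Rightarrow> 'h"
  assumes "bounded_clinear A" "\<And>x y. cinner (A x) y = cinner x (B y)"
  shows "cadjoint A = B"
proof
  show "cadjoint A y = B y" for y
    by (rule cinner_extensionality) (metis assms cinner_cadjoint cinner_commute)
qed

lemma cadjoint_cadjoint:
  fixes A :: "'h::findim_chilbert \<Rightarrow> 'h"
  assumes "bounded_clinear A"
  shows "cadjoint (cadjoint A) = A"
  by (rule cadjointI) (simp_all add: assms bounded_clinear_cadjoint cinner_cadjoint_left)

lemma cadjoint_comp:
  fixes A :: "'h::findim_chilbert \<Rightarrow> 'h"
  assumes "bounded_clinear A" "bounded_clinear B"
  shows "cadjoint (A \<circ> B) = cadjoint B \<circ> cadjoint A"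
  by (rule cadjointI) (simp_all add: assms bounded_clinear_comp cinner_cadjoint)

lemma unitary_opD:
  assumes "unitary_op A"
  shows "bounded_clinear A" "cadjoint A (A x) = x" "A (cadjoint A x) = x"
  using assms by (auto simp: unitary_op_def o_def id_def fun_eq_iff)

lemma unitary_cinner:
  fixes A :: "'h::findim_chilbert \<Rightarrow> 'h"
  assumes "unitary_op A"
  shows "cinner (A x) (A y) = cinner x y"
  using cinner_cadjoint[OF unitary_opD(1)[OF assms]] unitary_opD[OF assms] by simp

lemma unitary_norm:
  fixes A :: "'h::findim_chilbert \<Rightarrow> 'h"
  assumes "unitary_op A"
  shows "norm (A x) = norm x"
  using unitary_cinner[OF assms, of x x] unfolding cinner_self of_real_eq_iff by simp

lemma unitary_cadjoint:
  fixes A :: "'h::findim_chilbert \<Rightarrow> 'h"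
  assumes "unitary_op A"
  shows "unitary_op (cadjoint A)"
  using assms
  by (simp add: unitary_op_def bounded_clinear_cadjoint cadjoint_cadjoint)

lemma unitary_comp:
  fixes A :: "'h::findim_chilbert \<Rightarrow> 'h"
  assumes "unitary_op A" "unitary_op B"
  shows "unitary_op (A \<circ> B)"
  using unitary_opD[OF assms(1)] unitary_opD[OF assms(2)]
  by (simp add: unitary_op_def bounded_clinear_comp cadjoint_comp fun_eq_iff)

text \<open>
  If \<open>A\<close> preserves inner products, then \<open>A\<^sup>* A = 1\<close>, and \<open>A A\<^sup>*\<close> is a projection with the same
  trace as \<open>A\<^sup>* A\<close>, which is the dimension.  As each basis vector contributes at most \<open>1\<close> to this
  trace, each contributes exactly \<open>1\<close>, and so is fixed by the projection.
\<close>
lemma unitary_if_isometry: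
  fixes A :: "'h::findim_chilbert \<Rightarrow> 'h"
  assumes A: "bounded_clinear A"
    and iso: "\<And>e f. e \<in> onb \<Longrightarrow> f \<in> onb \<Longrightarrow> cinner (A e) (A f) = cinner e f"
  shows "unitary_op A"
proof -
  note bc = bounded_clinear_cadjoint[OF A]
  have "cadjoint A \<circ> A = id"
  proof (rule bounded_clinear_ext)
    fix e :: 'h assume e: "e \<in> onb"
    have "cadjoint A (A e) = e"
      by (rule onb_eqI) (simp add: cinner_cadjoint_left[OF A] iso[OF e])
    then show "(cadjoint A \<circ> A) e = id e" by simp
  qed (auto intro: bounded_clinear_comp bounded_clinear_id A bc)
  then have left: "cadjoint A (A x) = x" for x by (metis comp_apply id_apply)
  have nA: "norm (A x) = norm x" for x
    using cinner_cadjoint[OF A, of x "A x"] left[of x] unfolding cinner_self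
    by (simp add: cinner_self flip: of_real_power)
  have contr: "norm (cadjoint A x) \<le> norm x" for x
  proof -
    have "cinner (A (cadjoint A x)) x = complex_of_real ((norm (cadjoint A x))\<^sup>2)"
      by (simp add: cinner_cadjoint[OF A] cinner_self)
    then have "(norm (cadjoint A x))\<^sup>2 = cmod (cinner (A (cadjoint A x)) x)"
      by (simp del: of_real_power)
    also have "\<dots> \<le> norm (cadjoint A x) * norm x"
      using cinner_norm_le[of "A (cadjoint A x)" x] by (simp add: nA)
    finally show ?thesis
      by (cases "norm (cadjoint A x) = 0") (auto simp: power2_eq_square)
  qed
  have n1: "norm e = 1" if "e \<in> onb" for e :: 'h
    using onb_cinner[OF that that] cinner_self[of e]
    by (metis norm_ge_zero of_real_eq_1_iff power2_eq_1_iff abs_of_nonneg real_sqrt_abs real_sqrt_one)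
  have "(\<Sum>e\<in>onb. (norm (cadjoint A e))\<^sup>2) = (\<Sum>e\<in>onb. \<Sum>f\<in>onb. (cmod (cinner (cadjoint A e) f))\<^sup>2)"
    by (intro sum.cong refl onb_norm)
  also have "\<dots> = (\<Sum>f\<in>onb. \<Sum>e\<in>onb. (cmod (cinner (A f) e))\<^sup>2)"
    unfolding cinner_cadjoint_left[OF A]
    by (subst sum.swap) (simp only: cmod_cinner_commute)
  also have "\<dots> = (\<Sum>f\<in>(onb::'h set). 1)"
    by (intro sum.cong refl) (simp only: onb_norm[symmetric] nA n1 power_one)
  finally have trace: "(\<Sum>e\<in>onb. 1 - (norm (cadjoint A e))\<^sup>2) = 0" by (simp add: sum_subtractf)
  have "norm (cadjoint A e) \<le> 1" if "e \<in> onb" for e using contr[of e] n1[OF that] by simp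
  then have "1 - (norm (cadjoint A e))\<^sup>2 = 0" if "e \<in> onb" for e
    using that trace
    by (subst (asm) sum_nonneg_eq_0_iff) (auto simp: abs_square_le_1)
  then have nadj: "(norm (cadjoint A e))\<^sup>2 = 1" if "e \<in> onb" for e using that by simp
  have "A \<circ> cadjoint A = id"
  proof (rule bounded_clinear_ext)
    fix e :: 'h assume e: "e \<in> onb"
    have "(norm (A (cadjoint A e) - e))\<^sup>2 = 0"
      unfolding cinner_polarise cinner_cadjoint[OF A] nA cinner_self
      using nadj[OF e] n1[OF e] by (simp flip: of_real_power)
    then show "(A \<circ> cadjoint A) e = id e" by simp
  qed (auto intro: bounded_clinear_comp bounded_clinear_id A bc)
  then show ?thesis using \<open>cadjoint A \<circ> A = id\<close> A by (simp add: unitary_op_def)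
qed

lemma conjugationD:
  assumes "conjugation J"
  shows "J (x + y) = J x + J y" "J (c *\<^sub>C x) = cnj c *\<^sub>C J x" "J (J x) = x"
    "cinner (J x) (J y) = cinner y x"
  using assms by (auto simp: conjugation_def)

lemma conjugation_norm: "conjugation J \<Longrightarrow> norm (J x) = norm x"
  using conjugationD(4)[of J x x] unfolding cinner_self of_real_eq_iff by simp

lemma conjugation_bounded_linear:
  fixes J :: "'h::findim_chilbert \<Rightarrow> 'h"
  assumes "conjugation J"
  shows "bounded_linear J"
  by (rule bounded_linear_findim)
    (simp_all add: conjugationD[OF assms] conjugation_norm[OF assms] norm_scaleC scaleR_scaleC)

lemma conjugation_cinner_swap: "conjugation J \<Longrightarrow> cinner (J x) y = cinner (J y) x"
  by (metis conjugationD(3,4))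

lemma bounded_clinear_conj:
  fixes A :: "'h::findim_chilbert \<Rightarrow> 'h"
  assumes "conjugation J" "bounded_clinear A"
  shows "bounded_clinear (J \<circ> A \<circ> J)"
  by (rule bounded_clinearI) (simp_all add: bounded_clinear_simps[OF assms(2)] conjugationD[OF assms(1)])

lemma cadjoint_conj:
  fixes A :: "'h::findim_chilbert \<Rightarrow> 'h"
  assumes J: "conjugation J" and A: "bounded_clinear A"
  shows "cadjoint (J \<circ> A \<circ> J) = J \<circ> cadjoint A \<circ> J"
proof (rule cadjointI[OF bounded_clinear_conj[OF assms]])
  fix x y
  have "cinner (J (A (J x))) y = cinner (J y) (A (J x))" by (rule conjugation_cinner_swap[OF J])
  also have "\<dots> = cinner (cadjoint A (J y)) (J x)" by (simp add: cinner_cadjoint_left[OF A])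
  also have "\<dots> = cinner x (J (cadjoint A (J y)))"
    by (metis J conjugationD(3,4))
  finally show "cinner ((J \<circ> A \<circ> J) x) y = cinner x ((J \<circ> cadjoint A \<circ> J) y)" by simp
qed

lemma unitary_conj:
  fixes A :: "'h::findim_chilbert \<Rightarrow> 'h"
  assumes J: "conjugation J" and A: "unitary_op A"
  shows "unitary_op (J \<circ> A \<circ> J)"
  using unitary_opD[OF A]
  by (simp add: unitary_op_def bounded_clinear_conj[OF J] cadjoint_conj[OF J] fun_eq_iff
      conjugationD(3)[OF J])


section \<open>The circle and its trigonometric monomials\<close>

lemma space_circle [simp]: "space circle_measure = sphere 0 1"
  by (simp add: circle_measure_def space_restrict_space)

lemma sets_circle [measurable_cong]:
  "sets circle_measure = sets (restrict_space borel (sphere 0 1))"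
  by (simp add: circle_measure_def)

lemma borel_measurable_circle_ident [measurable]: "(\<lambda>z. z) \<in> borel_measurable circle_measure"
  unfolding measurable_cong_sets[OF sets_circle refl]
  by (rule measurable_restrict_space1) simp

lemma borel_measurable_circle: "f \<in> borel_measurable borel \<Longrightarrow> f \<in> borel_measurable circle_measure"
  using measurable_compose[OF borel_measurable_circle_ident] .

lemma borel_measurable_cnj [measurable]: "cnj \<in> borel_measurable borel"
  by (intro borel_measurable_continuous_onI continuous_intros)

lemma measurable_cnj_circle: "cnj \<in> measurable circle_measure circle_measure"
proof -
  have "cnj \<in> borel_measurable circle_measure"
    by (intro borel_measurable_circle borel_measurable_cnj)
  then show ?thesis
    unfolding measurable_cong_sets[OF refl sets_circle]
    by (rule measurable_restrict_space2[rotated]) auto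
qed

lemma measurable_cis: "cis \<in> measurable lborel (restrict_space borel (sphere 0 1))"
  by (rule measurable_restrict_space2)
    (auto intro!: borel_measurable_continuous_onI continuous_intros)

lemma borel_measurable_powi [measurable]: "(\<lambda>z. z powi n) \<in> borel_measurable circle_measure"
proof -
  have "(\<lambda>z::complex. z powi n) \<in> borel_measurable borel"
    unfolding power_int_def by measurable
  then show ?thesis by (rule borel_measurable_circle)
qed

lemma emeasure_circle: "emeasure circle_measure (sphere 0 1) = 1"
proof -
  have "cis -` sphere 0 1 \<inter> space (uniform_measure lborel {0..<2 * pi}) = UNIV" by auto
  moreover have "cis \<in> measurable (uniform_measure lborel {0..<2 * pi}) (restrict_space borel (sphere 0 1))"
    using measurable_cis by simp
  ultimately show ?thesis
    unfolding circle_measure_def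
    by (subst emeasure_distr)
      (auto simp: sets_restrict_space divide_eq_1_ennreal ennreal_divide_self intro!: image_eqI[of _ _ UNIV])
qed

interpretation circle: finite_measure circle_measure
  by standard (simp add: emeasure_circle)

lemma norm_powi_circle: "z \<in> sphere 0 1 \<Longrightarrow> cmod (z powi n) = 1"
  by (simp add: norm_power_int)

lemma powi_add_circle: "z \<in> sphere 0 1 \<Longrightarrow> z powi (m + n) = z powi m * (z::complex) powi n"
  by (rule power_int_add) auto

lemma cnj_powi_circle:
  assumes "z \<in> sphere 0 1"
  shows "cnj (z powi n) = z powi (- n)"
proof -
  have "z * cnj z = 1" using assms by (simp add: complex_norm_square[symmetric])
  then have "cnj z = inverse z" by (metis inverse_unique)
  then show ?thesis by (simp add: power_int_minus power_int_inverse)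
qed

lemma integral_powi_circle: "(\<integral>z. z powi n \<partial>circle_measure) = (if n = 0 then 1 else 0)"
proof (cases "n = 0")
  case True
  then show ?thesis by (simp add: measure_def emeasure_circle)
next
  case False
  have meas: "(\<lambda>z::complex. z powi n) \<in> borel_measurable (restrict_space borel (sphere 0 1))"
    using borel_measurable_powi[of n] unfolding measurable_cong_sets[OF sets_circle refl] .
  have cis_meas: "cis \<in> borel_measurable borel"
    by (auto intro!: borel_measurable_continuous_onI continuous_intros)
  have "(\<lambda>t. cis t powi n) \<in> borel_measurable borel"
    unfolding cis_power_int by (auto intro!: borel_measurable_continuous_onI continuous_intros)
  then have pm: "(\<lambda>t. cis t powi n) \<in> borel_measurable lborel" by simp
  have dens: "uniform_measure lborel {0..<2 * pi} =
      density lborel (\<lambda>t. ennreal (indicator {0..<2 * pi} t / (2 * pi)))"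
    unfolding uniform_measure_def
    by (intro density_cong) (auto simp: divide_ennreal[symmetric] ennreal_indicator split: split_indicator)
  define F where "F t = cis (of_int n * t) / (\<i> * of_int n)" for t :: real
  have "(\<integral>z. z powi n \<partial>circle_measure) =
      (\<integral>t. (indicator {0..<2 * pi} t / (2 * pi)) *\<^sub>R cis t powi n \<partial>lborel)"
    unfolding circle_measure_def using measurable_cis
    by (subst integral_distr) (auto simp: meas dens integral_density[OF pm])
  also have "\<dots> = (\<integral>t. (1 / (2 * pi)) *\<^sub>R (indicator {0..2 * pi} t *\<^sub>R cis (of_int n * t)) \<partial>lborel)"
  proof (rule integral_cong_AE)
    have "AE t in lborel. t \<noteq> 2 * pi" by (rule AE_lborel_singleton)
    then show "AE t in lborel. (indicator {0..<2 * pi} t / (2 * pi)) *\<^sub>R cis t powi n =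
        (1 / (2 * pi)) *\<^sub>R (indicator {0..2 * pi} t *\<^sub>R cis (of_int n * t))"
      by eventually_elim (auto simp: cis_power_int split: split_indicator)
  qed (use pm in \<open>simp_all add: cis_power_int\<close>)
  also have "\<dots> = (1 / (2 * pi)) *\<^sub>R (F (2 * pi) - F 0)"
  proof (subst integral_scaleR_right, subst integral_FTC_atLeastAtMost)
    show "(F has_vector_derivative cis (of_int n * t)) (at t within {0..2 * pi})" for t
    proof -
      define c where "c = \<i> * complex_of_int n"
      have "c \<noteq> 0" using False by (simp add: c_def)
      then have "((\<lambda>w. exp (c * w) / c) has_field_derivative exp (c * of_real t)) (at (of_real t))"
        by (auto intro!: derivative_eq_intros)
      from has_vector_derivative_real_field[OF this] show ?thesis
        by (simp add: F_def[abs_def] cis_conv_exp c_def mult.assoc)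
    qed
    show "continuous_on {0..2 * pi} (\<lambda>t. cis (of_int n * t))"
      by (intro continuous_intros)
  qed auto
  also have "F (2 * pi) = F 0"
    using cis_multiple_2pi[of "of_int n"] by (simp add: F_def mult_ac)
  finally show ?thesis using False by simp
qed

section \<open>A functional monotone class theorem on the circle\<close>

text \<open>
  A class of bounded functions that contains the monomials \<open>z\<^sup>n\<close> for all integers \<open>n\<close>, and
  is closed under linear combinations and bounded pointwise limits, contains every bounded Borel
  function: on the circle polynomials in the real and imaginary part are combinations of monomials,
  so Stone--Weierstrass gives the continuous functions, these give the indicators of closed sets,
  and Dynkin's theorem gives those of all Borel sets.
\<close>
locale circle_function_class =
  fixes P :: "(complex \<Rightarrow> complex) \<Rightarrow> bool"
  assumes P_monomial: "\<And>n. P (\<lambda>z. z powi n)"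
    and P_add: "\<And>f g. P f \<Longrightarrow> P g \<Longrightarrow> P (\<lambda>z. f z + g z)"
    and P_scale: "\<And>c f. P f \<Longrightarrow> P (\<lambda>z. c * f z)"
    and P_limit: "\<And>f g B. (\<And>i::nat. P (f i)) \<Longrightarrow> (\<And>i z. z \<in> sphere 0 1 \<Longrightarrow> cmod (f i z) \<le> B) \<Longrightarrow>
        (\<And>z. z \<in> sphere 0 1 \<Longrightarrow> (\<lambda>i. f i z) \<longlonglongrightarrow> g z) \<Longrightarrow> P g"
    and P_bounded: "\<And>f. P f \<Longrightarrow> \<exists>B. \<forall>z\<in>sphere 0 1. cmod (f z) \<le> B"
begin

lemma cong:
  assumes "P f" "\<And>z. z \<in> sphere 0 1 \<Longrightarrow> f z = g z"
  shows "P g"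
proof -
  obtain B where "\<forall>z\<in>sphere 0 1. cmod (f z) \<le> B" using P_bounded[OF assms(1)] by blast
  then show ?thesis using P_limit[of "\<lambda>_. f" B g] assms by simp
qed

lemma zero: "P (\<lambda>z. 0)" and one: "P (\<lambda>z. 1)"
  using P_scale[OF P_monomial[of 0], of 0] P_monomial[of 0] by simp_all

lemma sum: "(\<And>i. i \<in> I \<Longrightarrow> P (f i)) \<Longrightarrow> P (\<lambda>z. \<Sum>i\<in>I. f i z)"
proof (induction I rule: infinite_finite_induct)
  case (insert i I)
  then show ?case using P_add[of "f i" "\<lambda>z. \<Sum>i\<in>I. f i z"] by simp
qed (simp_all add: zero)

text \<open>
  The statement is closed under products of polynomials because it speaks of the multiplier
  rather than of the function.
\<close>
lemma polynomial_multiplier: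
  assumes "real_polynomial_function p" "\<And>n. P (\<lambda>z. z powi n * f z)"
  shows "P (\<lambda>z. z powi n * (complex_of_real (p z) * f z))"
  using assms
proof (induction arbitrary: f n rule: real_polynomial_function.induct)
  case (linear p)
  interpret p: bounded_linear p by (rule linear.hyps)
  have p: "complex_of_real (p z) =
      (p 1 / 2 - \<i> * p \<i> / 2) * z + (p 1 / 2 + \<i> * p \<i> / 2) * cnj z" for z
  proof -
    have "p z = p (Re z *\<^sub>R 1 + Im z *\<^sub>R \<i>)"
      by (rule arg_cong[where f = p]) (simp add: complex_eq_iff)
    also have "\<dots> = Re z * p 1 + Im z * p \<i>" by (simp only: p.add p.scaleR real_scaleR_def)
    finally show ?thesis by (simp add: complex_eq_iff algebra_simps)
  qed
  have z: "z powi n * z = z powi (n + 1)" "z powi n * cnj z = z powi (n - 1)"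
    if "z \<in> sphere 0 1" for z
    using powi_add_circle[OF that, of n 1] powi_add_circle[OF that, of n "-1"]
      cnj_powi_circle[OF that, of 1] by simp_all
  have "P (\<lambda>z. (p 1 / 2 - \<i> * p \<i> / 2) * (z powi (n + 1) * f z) +
      (p 1 / 2 + \<i> * p \<i> / 2) * (z powi (n - 1) * f z))"
    by (intro P_add P_scale linear.prems)
  then show ?case
  proof (rule cong)
    fix z :: complex assume "z \<in> sphere 0 1"
    note zs = z[OF this, symmetric]
    show "(p 1 / 2 - \<i> * p \<i> / 2) * (z powi (n + 1) * f z) +
        (p 1 / 2 + \<i> * p \<i> / 2) * (z powi (n - 1) * f z) =
        z powi n * (complex_of_real (p z) * f z)"
      by (simp only: zs p[of z]) (simp only: algebra_simps)
  qed
next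
  case (const c)
  then show ?case using P_scale[OF const, of "complex_of_real c" n] by (simp add: mult_ac)
next
  case (add p q)
  then show ?case using P_add[OF add.IH(1)[OF add.prems, of n] add.IH(2)[OF add.prems, of n]]
    by (simp add: algebra_simps)
next
  case (mult p q)
  have "P (\<lambda>z. z powi n * (complex_of_real (p z) * (complex_of_real (q z) * f z)))"
    by (intro mult)
  then show ?case by (simp add: mult.assoc)
qed

lemma continuous:
  assumes "continuous_on (sphere 0 1) g"
  shows "P (\<lambda>z. complex_of_real (g z))"
proof -
  have "\<exists>p. real_polynomial_function p \<and> (\<forall>z\<in>sphere 0 1. \<bar>g z - p z\<bar> < inverse (real (Suc i)))" for i
    using Stone_Weierstrass_real_polynomial_function[OF compact_sphere assms, of "inverse (real (Suc i))"]
    by (metis inverse_positive_iff_positive of_nat_0_less_iff zero_less_Suc)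
  then obtain p where p: "\<And>i. real_polynomial_function (p i)"
    "\<And>i z. z \<in> sphere 0 1 \<Longrightarrow> \<bar>g z - p i z\<bar> < inverse (real (Suc i))"
    by metis
  have "bounded (g ` sphere 0 1)"
    by (intro compact_imp_bounded compact_continuous_image assms compact_sphere)
  then obtain B where B: "\<And>z. z \<in> sphere 0 1 \<Longrightarrow> \<bar>g z\<bar> \<le> B" unfolding bounded_iff by (metis imageI real_norm_def)
  show ?thesis
  proof (rule P_limit)
    show "P (\<lambda>z. complex_of_real (p i z))" for i
      using polynomial_multiplier[OF p(1), of "\<lambda>_. 1" 0 i] P_monomial by simp
    fix z :: complex assume z: "z \<in> sphere 0 1"
    show "cmod (complex_of_real (p i z)) \<le> B + 1" for i
    proof -
      have "inverse (real (Suc i)) \<le> 1" by (simp add: field_simps)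
      then show ?thesis using B[OF z] p(2)[OF z, of i] by (simp only: norm_of_real)
    qed
    have "norm (p i z - g z) \<le> inverse (real (Suc i))" for i
      using p(2)[OF z, of i] by (simp only: real_norm_def abs_minus_commute[of "p i z"] less_imp_le)
    then have "(\<lambda>i. p i z - g z) \<longlonglongrightarrow> 0"
      by (intro Lim_null_comparison[OF always_eventually LIMSEQ_inverse_real_of_nat] allI)
    from LIM_zero_cancel[OF this]
    show "(\<lambda>i. complex_of_real (p i z)) \<longlonglongrightarrow> complex_of_real (g z)" by (rule tendsto_of_real)
  qed
qed

lemma indicator_closed:
  assumes "closed A"
  shows "P (indicator A)"
proof (cases "A = {}")
  case True
  then show ?thesis using zero by (simp add: indicator_def[abs_def])
next
  case False
  define g where "g i z = max 0 (1 - real i * infdist z A)" for i and z :: complex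
  show ?thesis
  proof (rule P_limit)
    show "P (\<lambda>z. complex_of_real (g i z))" for i
      unfolding g_def by (intro continuous continuous_intros)
    show "cmod (complex_of_real (g i z)) \<le> 1" for i z
      by (auto simp: g_def infdist_nonneg)
    fix z
    have "(\<lambda>i. g i z) \<longlonglongrightarrow> indicator A z"
    proof (cases "z \<in> A")
      case True
      then show ?thesis by (simp add: g_def)
    next
      case zA: False
      then have pos: "infdist z A > 0" using assms False infdist_pos_not_in_closed by blast
      obtain N where N: "real N * infdist z A > 1" using reals_Archimedean3[OF pos] by blast
      have "g i z = 0" if "i \<ge> N" for i
      proof -
        have "real N * infdist z A \<le> real i * infdist z A" using pos that by simp
        then show ?thesis using N by (simp add: g_def)
      qed
      then have "eventually (\<lambda>i. g i z = indicator A z) sequentially"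
        using zA by (auto simp: eventually_sequentially)
      then show ?thesis by (rule tendsto_eventually)
    qed
    then have "(\<lambda>i. complex_of_real (g i z)) \<longlonglongrightarrow> complex_of_real (indicator A z)" by (rule tendsto_of_real)
    also have "complex_of_real (indicator A z) = indicator A z" by (simp add: indicator_def)
    finally show "(\<lambda>i. complex_of_real (g i z)) \<longlonglongrightarrow> indicator A z" .
  qed
qed

lemma indicator_borel:
  assumes "A \<in> sets borel"
  shows "P (indicator A)"
proof -
  have "Int_stable (Collect closed :: complex set set)" by (auto simp: Int_stable_def)
  moreover have "Collect closed \<subseteq> Pow (UNIV :: complex set)" by simp
  moreover have "A \<in> sigma_sets UNIV (Collect closed)"
    using assms by (simp add: borel_eq_closed)
  ultimately show ?thesis
  proof (induction rule: sigma_sets_induct_disjoint)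
    case (basic A)
    then show ?case by (simp add: indicator_closed)
  next
    case empty
    show ?case by (rule indicator_closed) simp
  next
    case (compl A)
    have "P (\<lambda>z. 1 + (-1) * indicator A z)" by (intro P_add one P_scale compl)
    then show ?case by (rule cong) (simp add: indicator_def)
  next
    case (union A)
    show ?case
    proof (rule P_limit)
      show "P (\<lambda>z. indicator (\<Union>i<n. A i) z)" for n :: nat
      proof -
        have "P (\<lambda>z. \<Sum>i<n. indicator (A i) z)" by (intro sum union)
        moreover have "disjoint_family_on A {..<n}"
          using union by (auto simp: disjoint_family_on_def)
        ultimately show ?thesis by (simp add: indicator_UN_disjoint)
      qed
      show "cmod (indicator (\<Union>i<n. A i) z) \<le> 1" for n :: nat and z
        by (simp add: indicator_def)
    qed (rule LIMSEQ_indicator_UN)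
  qed
qed

theorem bounded_measurable:
  assumes f: "f \<in> borel_measurable circle_measure" and B: "\<And>z. z \<in> sphere 0 1 \<Longrightarrow> cmod (f z) \<le> B"
  shows "P f"
proof -
  obtain s where s: "\<forall>i. simple_function circle_measure (s i)"
    "\<forall>z\<in>sphere 0 1. (\<lambda>i. s i z) \<longlonglongrightarrow> f z"
    "\<forall>i. \<forall>z\<in>sphere 0 1. cmod (s i z) \<le> 2 * cmod (f z)"
    using borel_measurable_implies_sequence_metric[OF f, of 0] unfolding dist_norm diff_zero
      space_circle by blast
  show ?thesis
  proof (rule P_limit)
    fix i
    have ind: "P (indicator (s i -` {y} \<inter> sphere 0 1))" for y
    proof -
      have "s i -` {y} \<inter> sphere 0 1 \<in> sets circle_measure"
        using simple_functionD(2)[OF s(1)[rule_format], of i "{y}"] by simp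
      then show ?thesis
        by (auto simp: sets_circle sets_restrict_space intro!: indicator_borel)
    qed
    have "P (\<lambda>z. \<Sum>y\<in>s i ` sphere 0 1. y * indicator (s i -` {y} \<inter> sphere 0 1) z)"
      by (intro sum P_scale ind)
    then show "P (s i)"
    proof (rule cong)
      fix z :: complex assume "z \<in> sphere 0 1"
      then have "s i z = (\<Sum>y\<in>s i ` sphere 0 1. indicator (s i -` {y} \<inter> sphere 0 1) z *\<^sub>R y)"
        using simple_function_indicator_representation_banach[OF s(1)[rule_format], of z i]
        unfolding space_circle by blast
      also have "\<dots> = (\<Sum>y\<in>s i ` sphere 0 1. y * indicator (s i -` {y} \<inter> sphere 0 1) z)"
        by (intro sum.cong refl) (simp add: indicator_def)
      finally show "(\<Sum>y\<in>s i ` sphere 0 1. y * indicator (s i -` {y} \<inter> sphere 0 1) z) = s i z" ..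
    qed
  next
    show "cmod (s i z) \<le> 2 * B" if "z \<in> sphere 0 1" for i z
      using s(3) that B[OF that] by (meson mult_left_mono order_trans zero_le_numeral)
    show "(\<lambda>i. s i z) \<longlonglongrightarrow> f z" if "z \<in> sphere 0 1" for z
      using s(2) that by blast
  qed
qed

end


section \<open>Fourier uniqueness, reflection and products of Hardy functions\<close>

definition circle_bounded :: "(complex \<Rightarrow> complex) \<Rightarrow> bool" where
  "circle_bounded f \<longleftrightarrow>
     f \<in> borel_measurable circle_measure \<and> (\<exists>B. \<forall>z\<in>sphere 0 1. cmod (f z) \<le> B)"

lemma circle_boundedI:
  "f \<in> borel_measurable circle_measure \<Longrightarrow> (\<And>z. z \<in> sphere 0 1 \<Longrightarrow> cmod (f z) \<le> B) \<Longrightarrow> circle_bounded f"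
  unfolding circle_bounded_def by blast

lemma circle_bounded_measurable [measurable_dest]:
  "circle_bounded f \<Longrightarrow> f \<in> borel_measurable circle_measure"
  by (simp add: circle_bounded_def)

lemma circle_bounded_bound: "circle_bounded f \<Longrightarrow> \<exists>B. \<forall>z\<in>sphere 0 1. cmod (f z) \<le> B"
  by (simp add: circle_bounded_def)

lemma circle_bounded_powi: "circle_bounded (\<lambda>z. z powi n)"
  by (rule circle_boundedI[of _ 1]) (simp_all add: norm_powi_circle del: mem_sphere_0)

lemma circle_bounded_const: "circle_bounded (\<lambda>z. c)"
  by (rule circle_boundedI[of _ "cmod c"]) simp_all

lemma circle_bounded_add:
  assumes "circle_bounded f" "circle_bounded g"
  shows "circle_bounded (\<lambda>z. f z + g z)"
proof -
  obtain B C where B: "\<And>z. z \<in> sphere 0 1 \<Longrightarrow> cmod (f z) \<le> B" and C: "\<And>z. z \<in> sphere 0 1 \<Longrightarrow> cmod (g z) \<le> C"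
    using assms by (metis circle_bounded_def)
  show ?thesis
  proof (rule circle_boundedI)
    show "(\<lambda>z. f z + g z) \<in> borel_measurable circle_measure" using assms by measurable
    show "cmod (f z + g z) \<le> B + C" if "z \<in> sphere 0 1" for z
      using norm_triangle_ineq[of "f z" "g z"] B[OF that] C[OF that] by linarith
  qed
qed

lemma circle_bounded_mult:
  assumes "circle_bounded f" "circle_bounded g"
  shows "circle_bounded (\<lambda>z. f z * g z)"
proof -
  obtain B C where B: "\<And>z. z \<in> sphere 0 1 \<Longrightarrow> cmod (f z) \<le> B" and C: "\<And>z. z \<in> sphere 0 1 \<Longrightarrow> cmod (g z) \<le> C"
    using assms by (metis circle_bounded_def)
  show ?thesis
  proof (rule circle_boundedI)
    show "(\<lambda>z. f z * g z) \<in> borel_measurable circle_measure" using assms by measurable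
    show "cmod (f z * g z) \<le> B * C" if "z \<in> sphere 0 1" for z
      unfolding norm_mult using B[OF that] C[OF that]
      by (intro mult_mono) (auto intro: order_trans[OF norm_ge_zero])
  qed
qed

lemma circle_bounded_scale: "circle_bounded f \<Longrightarrow> circle_bounded (\<lambda>z. c * f z)"
  by (intro circle_bounded_mult circle_bounded_const)

lemma circle_bounded_diff: "circle_bounded f \<Longrightarrow> circle_bounded g \<Longrightarrow> circle_bounded (\<lambda>z. f z - g z)"
  using circle_bounded_add[OF _ circle_bounded_scale[of g "-1"], of f] by simp

lemma circle_bounded_cnj:
  assumes "circle_bounded f"
  shows "circle_bounded (\<lambda>z. cnj (f z))"
proof -
  have "(\<lambda>z. cnj (f z)) \<in> borel_measurable circle_measure"
    by (rule measurable_compose[OF circle_bounded_measurable[OF assms] borel_measurable_cnj])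
  then show ?thesis using circle_bounded_bound[OF assms] by (simp add: circle_bounded_def)
qed

lemma circle_bounded_limit:
  assumes "\<And>i::nat. circle_bounded (f i)" "\<And>i z. z \<in> sphere 0 1 \<Longrightarrow> cmod (f i z) \<le> B"
    "\<And>z. z \<in> sphere 0 1 \<Longrightarrow> (\<lambda>i. f i z) \<longlonglongrightarrow> g z"
  shows "circle_bounded g"
proof (rule circle_boundedI)
  show "g \<in> borel_measurable circle_measure"
    by (rule borel_measurable_LIMSEQ_metric[of f]) (use assms in \<open>simp_all add: circle_bounded_def\<close>)
  show "cmod (g z) \<le> B" if "z \<in> sphere 0 1" for z
    by (rule Lim_bounded[OF tendsto_norm[OF assms(3)[OF that]]]) (use assms(2) that in auto)
qed

lemma integrable_circle_bounded_mult:
  assumes f: "circle_bounded f" and g: "integrable circle_measure g"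
  shows "integrable circle_measure (\<lambda>z. f z * g z)"
proof -
  obtain B where B: "\<And>z. z \<in> sphere 0 1 \<Longrightarrow> cmod (f z) \<le> B"
    using f by (metis circle_bounded_def)
  show ?thesis
  proof (rule Bochner_Integration.integrable_bound)
    show "integrable circle_measure (\<lambda>z. B * norm (g z))" using g by simp
    show "(\<lambda>z. f z * g z) \<in> borel_measurable circle_measure" using f g by measurable
    show "AE z in circle_measure. norm (f z * g z) \<le> norm (B * norm (g z))"
    proof (rule AE_I2)
      fix z assume "z \<in> space circle_measure"
      then have "cmod (f z) \<le> B" using B by simp
      then show "norm (f z * g z) \<le> norm (B * norm (g z))"
        by (simp add: norm_mult) (metis abs_ge_self mult_right_mono norm_ge_zero order_trans)
    qed
  qed
qed

lemma integrable_circle_bounded: "circle_bounded f \<Longrightarrow> integrable circle_measure f"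
  using integrable_circle_bounded_mult[of f "\<lambda>_. 1"] by simp

lemma integrable_circle_bounded_norm2:
  assumes "circle_bounded f"
  shows "integrable circle_measure (\<lambda>z. (cmod (f z))\<^sup>2)"
proof -
  have "integrable circle_measure (\<lambda>z. f z * cnj (f z))"
    by (intro integrable_circle_bounded circle_bounded_mult circle_bounded_cnj assms)
  from integrable_norm[OF this] show ?thesis by (simp add: norm_mult power2_eq_square)
qed

text \<open>
  An integrable function with vanishing Fourier coefficients annihilates the monomials, hence all
  bounded Borel functions, and in particular its own conjugate phase \<open>cnj (sgn g)\<close>; this pairing
  is its \<open>L\<^sup>1\<close> norm.
\<close>
lemma fourier_uniqueness:
  assumes g: "integrable circle_measure g" and zero: "\<And>n. (\<integral>z. z powi n * g z \<partial>circle_measure) = 0"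
  shows "AE z in circle_measure. g z = (0::complex)"
proof -
  interpret circle_function_class "\<lambda>f. circle_bounded f \<and> (\<integral>z. f z * g z \<partial>circle_measure) = 0"
  proof
    fix f1 f2
    assume *: "circle_bounded f1 \<and> (\<integral>z. f1 z * g z \<partial>circle_measure) = 0"
      "circle_bounded f2 \<and> (\<integral>z. f2 z * g z \<partial>circle_measure) = 0"
    then show "circle_bounded (\<lambda>z. f1 z + f2 z) \<and> (\<integral>z. (f1 z + f2 z) * g z \<partial>circle_measure) = 0"
      by (simp add: distrib_right circle_bounded_add Bochner_Integration.integral_add integrable_circle_bounded_mult[OF _ g])
  next
    fix f :: "nat \<Rightarrow> complex \<Rightarrow> complex" and h B
    assume f: "\<And>i. circle_bounded (f i) \<and> (\<integral>z. f i z * g z \<partial>circle_measure) = 0"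
      and B: "\<And>i z. z \<in> sphere 0 1 \<Longrightarrow> cmod (f i z) \<le> B"
      and lim: "\<And>z. z \<in> sphere 0 1 \<Longrightarrow> (\<lambda>i. f i z) \<longlonglongrightarrow> h z"
    have h: "circle_bounded h" using circle_bounded_limit[of f B h] f B lim by blast
    have "(\<lambda>i. \<integral>z. f i z * g z \<partial>circle_measure) \<longlonglongrightarrow> (\<integral>z. h z * g z \<partial>circle_measure)"
    proof (rule integral_dominated_convergence)
      show "(\<lambda>z. h z * g z) \<in> borel_measurable circle_measure" using h g by measurable
      show "(\<lambda>z. f i z * g z) \<in> borel_measurable circle_measure" for i
        using conjunct1[OF f[of i]] g by measurable
      show "integrable circle_measure (\<lambda>z. B * norm (g z))" using g by simp
      show "AE z in circle_measure. (\<lambda>i. f i z * g z) \<longlonglongrightarrow> h z * g z"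
        using lim by (intro AE_I2 tendsto_intros) auto
      show "AE z in circle_measure. norm (f i z * g z) \<le> B * norm (g z)" for i
        using B by (intro AE_I2) (auto simp: norm_mult intro!: mult_right_mono)
    qed
    then have "(\<integral>z. h z * g z \<partial>circle_measure) = 0"
      using f by (simp add: LIMSEQ_const_iff)
    then show "circle_bounded h \<and> (\<integral>z. h z * g z \<partial>circle_measure) = 0" using h by blast
  qed (use circle_bounded_bound in \<open>auto simp: zero circle_bounded_powi circle_bounded_scale mult.assoc
        simp del: mem_sphere_0\<close>)
  have "(\<integral>z. cnj (sgn (g z)) * g z \<partial>circle_measure) = 0"
  proof -
    have "(\<lambda>z. cnj (sgn (g z))) \<in> borel_measurable circle_measure"
      using g by measurable
    then show ?thesis
      using bounded_measurable[of "\<lambda>z. cnj (sgn (g z))" 1] by (auto simp: norm_sgn)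
  qed
  also have "(\<integral>z. cnj (sgn (g z)) * g z \<partial>circle_measure) = (\<integral>z. complex_of_real (cmod (g z)) \<partial>circle_measure)"
  proof (rule Bochner_Integration.integral_cong[OF refl])
    fix z
    have "cnj (sgn (g z)) * g z = g z * cnj (g z) / cmod (g z)" by (simp add: sgn_eq mult.commute)
    then show "cnj (sgn (g z)) * g z = complex_of_real (cmod (g z))"
      by (simp add: complex_norm_square[symmetric] power2_eq_square)
  qed
  finally have "(\<integral>z. cmod (g z) \<partial>circle_measure) = 0" by simp
  then show ?thesis
    using integral_nonneg_eq_0_iff_AE[OF integrable_norm[OF g]] by simp
qed

text \<open>Reflection maps \<open>z\<^sup>n\<close> to \<open>z\<^sup>-\<^sup>n\<close>, which has the same integral.\<close>
lemma distr_cnj: "distr circle_measure circle_measure cnj = circle_measure"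
proof -
  interpret circle_function_class
    "\<lambda>f. circle_bounded f \<and> (\<integral>z. f (cnj z) \<partial>circle_measure) = (\<integral>z. f z \<partial>circle_measure)"
  proof
    fix n
    have "(\<integral>z. cnj z powi n \<partial>circle_measure) = (\<integral>z. z powi (- n) \<partial>circle_measure)"
      by (rule Bochner_Integration.integral_cong[OF refl]) (simp flip: cnj_powi_circle)
    then show "circle_bounded (\<lambda>z. z powi n) \<and>
        (\<integral>z. cnj z powi n \<partial>circle_measure) = (\<integral>z. z powi n \<partial>circle_measure)"
      by (simp add: integral_powi_circle circle_bounded_powi)
  next
    fix f g
    assume *: "circle_bounded f \<and> (\<integral>z. f (cnj z) \<partial>circle_measure) = (\<integral>z. f z \<partial>circle_measure)"
      "circle_bounded g \<and> (\<integral>z. g (cnj z) \<partial>circle_measure) = (\<integral>z. g z \<partial>circle_measure)"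
    have "circle_bounded (\<lambda>z. h (cnj z))" if h: "circle_bounded h" for h
    proof -
      obtain B where "\<forall>z\<in>sphere 0 1. cmod (h z) \<le> B" using circle_bounded_bound[OF h] by blast
      then show ?thesis
        using h by (intro circle_boundedI[of _ B] measurable_compose[OF measurable_cnj_circle]) auto
    qed
    then show "circle_bounded (\<lambda>z. f z + g z) \<and>
        (\<integral>z. f (cnj z) + g (cnj z) \<partial>circle_measure) = (\<integral>z. f z + g z \<partial>circle_measure)"
      using * by (simp add: circle_bounded_add integrable_circle_bounded)
  next
    fix f :: "nat \<Rightarrow> complex \<Rightarrow> complex" and h B
    assume f: "\<And>i. circle_bounded (f i) \<and> (\<integral>z. f i (cnj z) \<partial>circle_measure) = (\<integral>z. f i z \<partial>circle_measure)"
      and B: "\<And>i z. z \<in> sphere 0 1 \<Longrightarrow> cmod (f i z) \<le> B"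
      and lim: "\<And>z. z \<in> sphere 0 1 \<Longrightarrow> (\<lambda>i. f i z) \<longlonglongrightarrow> h z"
    have h: "circle_bounded h" using circle_bounded_limit[of f B h] f B lim by blast
    have "(\<lambda>i. \<integral>z. f i (r z) \<partial>circle_measure) \<longlonglongrightarrow> (\<integral>z. h (r z) \<partial>circle_measure)"
      if r: "r \<in> measurable circle_measure circle_measure" for r
    proof (rule integral_dominated_convergence)
      have rz: "r z \<in> sphere 0 1" if "z \<in> space circle_measure" for z
        using measurable_space[OF r that] by simp
      show "(\<lambda>z. h (r z)) \<in> borel_measurable circle_measure"
        by (rule measurable_compose[OF r circle_bounded_measurable[OF h]])
      show "(\<lambda>z. f i (r z)) \<in> borel_measurable circle_measure" for i
        by (rule measurable_compose[OF r circle_bounded_measurable[OF conjunct1[OF f]]])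
      show "integrable circle_measure (\<lambda>z. B)" by simp
      show "AE z in circle_measure. (\<lambda>i. f i (r z)) \<longlonglongrightarrow> h (r z)"
        using lim rz by (intro AE_I2) blast
      show "AE z in circle_measure. norm (f i (r z)) \<le> B" for i
        using B rz by (intro AE_I2) blast
    qed
    from this[OF measurable_cnj_circle] this[OF measurable_ident]
    have "(\<integral>z. h (cnj z) \<partial>circle_measure) = (\<integral>z. h z \<partial>circle_measure)"
      using f LIMSEQ_unique by (simp add: id_def) blast
    then show "circle_bounded h \<and> (\<integral>z. h (cnj z) \<partial>circle_measure) = (\<integral>z. h z \<partial>circle_measure)"
      using h by blast
  qed (use circle_bounded_bound in \<open>auto simp: circle_bounded_scale simp del: mem_sphere_0\<close>)
  show ?thesis
  proof (rule measure_eqI)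
    fix A assume "A \<in> sets (distr circle_measure circle_measure cnj)"
    then have A: "A \<in> sets circle_measure" by simp
    have vA: "cnj -` A \<inter> sphere 0 1 \<in> sets circle_measure"
      using measurable_sets[OF measurable_cnj_circle A] by simp
    have ind: "(\<integral>z. (indicator B z :: complex) \<partial>circle_measure) = complex_of_real (measure circle_measure B)"
      if "B \<in> sets circle_measure" for B
    proof -
      have "(\<integral>z. (indicator B z :: complex) \<partial>circle_measure) =
          (\<integral>z. complex_of_real (indicator B z) \<partial>circle_measure)"
        by (rule Bochner_Integration.integral_cong) (simp_all add: indicator_def)
      also have "\<dots> = complex_of_real (measure circle_measure (B \<inter> space circle_measure))"
        by (simp only: integral_complex_of_real Bochner_Integration.integral_indicator)
      also have "B \<inter> space circle_measure = B" using sets.sets_into_space[OF that] by blast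
      finally show ?thesis .
    qed
    have "(\<integral>z. indicator A (cnj z) \<partial>circle_measure) = (\<integral>z. (indicator A z :: complex) \<partial>circle_measure)"
      using bounded_measurable[of "indicator A" 1] A by (auto simp: indicator_def)
    moreover have "(\<integral>z. (indicator A (cnj z) :: complex) \<partial>circle_measure) =
        (\<integral>z. indicator (cnj -` A \<inter> sphere 0 1) z \<partial>circle_measure)"
      by (rule Bochner_Integration.integral_cong) (auto simp: indicator_def)
    ultimately have "measure circle_measure (cnj -` A \<inter> sphere 0 1) = measure circle_measure A"
      by (simp only: ind[OF A] ind[OF vA] of_real_eq_iff)
    then show "emeasure (distr circle_measure circle_measure cnj) A = emeasure circle_measure A"
      using A by (simp add: emeasure_distr[OF measurable_cnj_circle A] circle.emeasure_eq_measure)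
  qed simp
qed

lemma AE_cnj: "AE z in circle_measure. Q z \<Longrightarrow> AE z in circle_measure. Q (cnj z)"
  using AE_distrD[OF measurable_cnj_circle, of Q] unfolding distr_cnj .

lemma integral_cnj_circle:
  fixes f :: "complex \<Rightarrow> 'b::{banach, second_countable_topology}"
  assumes "f \<in> borel_measurable circle_measure"
  shows "(\<integral>z. f (cnj z) \<partial>circle_measure) = (\<integral>z. f z \<partial>circle_measure)"
  using integral_distr[OF measurable_cnj_circle assms] by (simp add: distr_cnj)

lemma integrable_cnj_circle:
  fixes f :: "complex \<Rightarrow> 'b::{banach, second_countable_topology}"
  assumes "integrable circle_measure f"
  shows "integrable circle_measure (\<lambda>z. f (cnj z))"
  using integrable_distr[OF measurable_cnj_circle, of f] assms by (simp add: distr_cnj)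


lemma integrable_if_norm2:
  fixes f :: "complex \<Rightarrow> 'b::{banach, second_countable_topology}"
  assumes "f \<in> borel_measurable circle_measure" "integrable circle_measure (\<lambda>z. (norm (f z))\<^sup>2)"
  shows "integrable circle_measure f"
proof (rule Bochner_Integration.integrable_bound[OF _ assms(1)])
  show "integrable circle_measure (\<lambda>z. 1 + (norm (f z))\<^sup>2)" using assms(2) by simp
  have "x \<le> 1 + x\<^sup>2" for x :: real
    using zero_le_power2[of "x - 1/2"] by (simp add: power2_eq_square algebra_simps)
  then show "AE z in circle_measure. norm (f z) \<le> norm (1 + (norm (f z))\<^sup>2)"
    by (intro AE_I2) (auto intro: order_trans)
qed

text \<open>
  The product of a square-integrable function \<open>u\<close> and a bounded function \<open>v\<close>, both with vanishing
  negative Fourier coefficients, has vanishing negative Fourier coefficients.  This is clear when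
  \<open>v\<close> is an analytic trigonometric polynomial.  In general \<open>v\<close> is within \<open>\<epsilon>\<close> in \<open>L\<^sup>2\<close> of
  a sum \<open>q + r\<close> of an analytic and an antianalytic trigonometric polynomial, and as \<open>v - q\<close> is
  orthogonal to \<open>r\<close>, it is within \<open>\<epsilon>\<close> of \<open>q\<close>.  The predicates \<open>A\<close> and \<open>R\<close> below
  retain only the properties of \<open>q\<close> and \<open>r\<close> that this argument uses, so that no coefficients
  have to be handled.
\<close>
lemma hardy_product:
  assumes u: "u \<in> borel_measurable circle_measure" "integrable circle_measure (\<lambda>z. (cmod (u z))\<^sup>2)"
    and u0: "\<And>n. n > 0 \<Longrightarrow> (\<integral>z. z powi n * u z \<partial>circle_measure) = 0"
    and v: "circle_bounded v"
    and v0: "\<And>n. n > 0 \<Longrightarrow> (\<integral>z. z powi n * v z \<partial>circle_measure) = 0"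
    and n: "n > 0"
  shows "(\<integral>z. z powi n * (u z * v z) \<partial>circle_measure) = 0"
proof -
  have u1: "integrable circle_measure u"
    by (rule integrable_if_norm2[OF u])
  define A where "A q \<longleftrightarrow> circle_bounded q \<and> (\<forall>m>0. (\<integral>z. z powi m * q z \<partial>circle_measure) = 0) \<and>
      (\<forall>m>0. (\<integral>z. z powi m * (u z * q z) \<partial>circle_measure) = 0)" for q
  define R where "R r \<longleftrightarrow> circle_bounded r \<and>
      (\<forall>f. circle_bounded f \<longrightarrow> (\<forall>m>0. (\<integral>z. z powi m * f z \<partial>circle_measure) = 0) \<longrightarrow>
        (\<integral>z. f z * cnj (r z) \<partial>circle_measure) = 0)" for r
  define d where "d f g = (\<integral>z. (cmod (f z - g z))\<^sup>2 \<partial>circle_measure)" for f g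
  define near where "near f \<epsilon> \<longleftrightarrow> (\<exists>q r. A q \<and> R r \<and> d f (\<lambda>z. q z + r z) < \<epsilon>)" for f \<epsilon>
  note int = integrable_circle_bounded circle_bounded_mult circle_bounded_cnj circle_bounded_powi
    circle_bounded_add circle_bounded_diff circle_bounded_scale
  have umult: "integrable circle_measure (\<lambda>z. z powi m * (u z * f z))" if "circle_bounded f" for m f
    using integrable_circle_bounded_mult[OF circle_bounded_mult[OF circle_bounded_powi that] u1, of m]
    by (simp add: mult_ac)
  have A_add: "A (\<lambda>z. f z + g z)" if "A f" "A g" for f g
    using that by (simp add: A_def int umult distrib_left)
  have A_scale: "A (\<lambda>z. c * f z)" if "A f" for f c
  proof -
    have "(\<integral>z. z powi m * (c * f z) \<partial>circle_measure) = c * (\<integral>z. z powi m * f z \<partial>circle_measure)"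
      "(\<integral>z. z powi m * (u z * (c * f z)) \<partial>circle_measure) =
        c * (\<integral>z. z powi m * (u z * f z) \<partial>circle_measure)" for m
      by (simp_all add: mult.left_commute[of _ c])
    then show ?thesis using that by (simp add: A_def int)
  qed
  have R_add: "R (\<lambda>z. f z + g z)" if "R f" "R g" for f g
    using that by (simp add: R_def int distrib_left)
  have R_scale: "R (\<lambda>z. c * f z)" if "R f" for f c
    using that by (simp add: R_def int mult.left_commute[of _ "cnj c"])
  have A_zero: "A (\<lambda>z. 0)" and R_zero: "R (\<lambda>z. 0)"
    by (simp_all add: A_def R_def circle_bounded_const)
  have A_powi: "A (\<lambda>z. z powi k)" if "k \<ge> 0" for k
  proof -
    have "(\<integral>z. z powi m * (u z * z powi k) \<partial>circle_measure) = (\<integral>z. z powi (m + k) * u z \<partial>circle_measure)" for m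
      by (rule Bochner_Integration.integral_cong) (simp_all add: powi_add_circle mult_ac)
    moreover have "(\<integral>z. z powi m * z powi k \<partial>circle_measure) = (\<integral>z. z powi (m + k) \<partial>circle_measure)" for m
      by (rule Bochner_Integration.integral_cong) (simp_all add: powi_add_circle)
    ultimately show ?thesis using that by (simp add: A_def int u0 integral_powi_circle)
  qed
  have R_powi: "R (\<lambda>z. z powi k)" if "k < 0" for k
  proof -
    have "(\<integral>z. f z * cnj (z powi k) \<partial>circle_measure) = (\<integral>z. z powi (- k) * f z \<partial>circle_measure)" for f
      by (rule Bochner_Integration.integral_cong) (simp_all only: cnj_powi_circle space_circle mult.commute)
    then show ?thesis using that unfolding R_def by (simp add: int)
  qed
  have d_triangle: "d f h \<le> 2 * d f g + 2 * d g h"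
    if "circle_bounded f" "circle_bounded g" "circle_bounded h" for f g h
  proof -
    have "d f h \<le> (\<integral>z. 2 * (cmod (f z - g z))\<^sup>2 + 2 * (cmod (g z - h z))\<^sup>2 \<partial>circle_measure)"
      unfolding d_def
    proof (intro integral_mono)
      fix z
      have "cmod (f z - h z) \<le> cmod (f z - g z) + cmod (g z - h z)"
        using norm_triangle_ineq[of "f z - g z" "g z - h z"] by simp
      then have "(cmod (f z - h z))\<^sup>2 \<le> (cmod (f z - g z) + cmod (g z - h z))\<^sup>2" by (rule power_mono) simp
      also have "\<dots> \<le> 2 * (cmod (f z - g z))\<^sup>2 + 2 * (cmod (g z - h z))\<^sup>2"
        using zero_le_power2[of "cmod (f z - g z) - cmod (g z - h z)"]
        by (simp add: power2_eq_square algebra_simps)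
      finally show "(cmod (f z - h z))\<^sup>2 \<le> 2 * (cmod (f z - g z))\<^sup>2 + 2 * (cmod (g z - h z))\<^sup>2" .
    qed (use that in \<open>auto intro!: Bochner_Integration.integrable_add integrable_mult_right
            integrable_circle_bounded_norm2 circle_bounded_diff\<close>)
    then show ?thesis using that
      by (simp add: d_def integrable_circle_bounded_norm2 circle_bounded_diff)
  qed
  have AR_bdd: "circle_bounded (\<lambda>z. q z + r z)" if "A q" "R r" for q r
    using that by (simp add: A_def R_def circle_bounded_add)
  interpret circle_function_class "\<lambda>f. circle_bounded f \<and> (\<forall>\<epsilon>>0. near f \<epsilon>)"
  proof
    fix k
    have "near (\<lambda>z. z powi k) \<epsilon>" if "\<epsilon> > 0" for \<epsilon>
    proof (cases "k \<ge> 0")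
      case True
      show ?thesis unfolding near_def
        by (rule exI[of _ "\<lambda>z. z powi k"], rule exI[of _ "\<lambda>z. 0"])
          (use that True in \<open>simp add: A_powi R_zero d_def\<close>)
    next
      case False
      show ?thesis unfolding near_def
        by (rule exI[of _ "\<lambda>z. 0"], rule exI[of _ "\<lambda>z. z powi k"])
          (use that False in \<open>simp add: R_powi A_zero d_def\<close>)
    qed
    then show "circle_bounded (\<lambda>z. z powi k) \<and> (\<forall>\<epsilon>>0. near (\<lambda>z. z powi k) \<epsilon>)"
      by (simp add: circle_bounded_powi)
  next
    fix f g
    assume f: "circle_bounded f \<and> (\<forall>\<epsilon>>0. near f \<epsilon>)" and g: "circle_bounded g \<and> (\<forall>\<epsilon>>0. near g \<epsilon>)"
    have "near (\<lambda>z. f z + g z) \<epsilon>" if "\<epsilon> > 0" for \<epsilon>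
    proof -
      have "near f (\<epsilon> / 4)" "near g (\<epsilon> / 4)" using f g that by simp_all
      then obtain q r q' r' where q: "A q" "R r" "d f (\<lambda>z. q z + r z) < \<epsilon> / 4"
        and q': "A q'" "R r'" "d g (\<lambda>z. q' z + r' z) < \<epsilon> / 4" unfolding near_def by blast
      define s where "s = (\<lambda>z. (q z + q' z) + (r z + r' z))"
      have "d (\<lambda>z. f z + g z) s \<le> 2 * d (\<lambda>z. f z + g z) (\<lambda>z. (q z + r z) + g z)
          + 2 * d (\<lambda>z. (q z + r z) + g z) s"
        unfolding s_def
        by (intro d_triangle circle_bounded_add) (use f g q q' in \<open>auto simp: A_def R_def\<close>)
      also have "d (\<lambda>z. f z + g z) (\<lambda>z. (q z + r z) + g z) = d f (\<lambda>z. q z + r z)"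
        by (simp add: d_def)
      also have "d (\<lambda>z. (q z + r z) + g z) s = d g (\<lambda>z. q' z + r' z)"
        by (simp add: d_def s_def algebra_simps)
      finally have "d (\<lambda>z. f z + g z) (\<lambda>z. (q z + q' z) + (r z + r' z)) < \<epsilon>"
        using q q' unfolding s_def by linarith
      then show ?thesis
        unfolding near_def using A_add[OF q(1) q'(1)] R_add[OF q(2) q'(2)] by blast
    qed
    then show "circle_bounded (\<lambda>z. f z + g z) \<and> (\<forall>\<epsilon>>0. near (\<lambda>z. f z + g z) \<epsilon>)"
      using f g by (simp add: circle_bounded_add)
  next
    fix c f
    assume f: "circle_bounded f \<and> (\<forall>\<epsilon>>0. near f \<epsilon>)"
    have "near (\<lambda>z. c * f z) \<epsilon>" if "\<epsilon> > 0" for \<epsilon>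
    proof -
      have pos: "(cmod c)\<^sup>2 + 1 > 0" by (simp add: add_nonneg_pos)
      then have "near f (\<epsilon> / ((cmod c)\<^sup>2 + 1))" using f that by simp
      then obtain q r where q: "A q" "R r" "d f (\<lambda>z. q z + r z) < \<epsilon> / ((cmod c)\<^sup>2 + 1)"
        unfolding near_def by blast
      have "d (\<lambda>z. c * f z) (\<lambda>z. c * q z + c * r z) = (cmod c)\<^sup>2 * d f (\<lambda>z. q z + r z)"
        by (simp add: d_def flip: distrib_left right_diff_distrib)
          (simp add: norm_mult power_mult_distrib)
      also have "\<dots> \<le> ((cmod c)\<^sup>2 + 1) * d f (\<lambda>z. q z + r z)"
        by (intro mult_right_mono) (simp_all add: d_def)
      also have "\<dots> < \<epsilon>" using q(3) pos by (simp add: field_simps)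
      finally show ?thesis unfolding near_def using A_scale[OF q(1)] R_scale[OF q(2)] by blast
    qed
    then show "circle_bounded (\<lambda>z. c * f z) \<and> (\<forall>\<epsilon>>0. near (\<lambda>z. c * f z) \<epsilon>)"
      using f by (simp add: circle_bounded_scale)
  next
    fix f :: "nat \<Rightarrow> complex \<Rightarrow> complex" and h B
    assume f: "\<And>i. circle_bounded (f i) \<and> (\<forall>\<epsilon>>0. near (f i) \<epsilon>)"
      and B: "\<And>i z. z \<in> sphere 0 1 \<Longrightarrow> cmod (f i z) \<le> B"
      and lim: "\<And>z. z \<in> sphere 0 1 \<Longrightarrow> (\<lambda>i. f i z) \<longlonglongrightarrow> h z"
    have h: "circle_bounded h" using circle_bounded_limit[of f B h] f B lim by blast
    have "(\<lambda>i. d h (f i)) \<longlonglongrightarrow> (\<integral>z. 0 \<partial>circle_measure)"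
      unfolding d_def
    proof (rule integral_dominated_convergence)
      show "(\<lambda>z. (cmod (h z - f i z))\<^sup>2) \<in> borel_measurable circle_measure" for i
        using f h by (intro borel_measurable_integrable integrable_circle_bounded_norm2 circle_bounded_diff) auto
      show "integrable circle_measure (\<lambda>z. (2 * B)\<^sup>2)" by simp
      show "AE z in circle_measure. (\<lambda>i. (cmod (h z - f i z))\<^sup>2) \<longlonglongrightarrow> 0"
      proof (rule AE_I2)
        fix z assume "z \<in> space circle_measure"
        then have "(\<lambda>i. (cmod (h z - f i z))\<^sup>2) \<longlonglongrightarrow> (cmod (h z - h z))\<^sup>2"
          using lim by (intro tendsto_intros) auto
        then show "(\<lambda>i. (cmod (h z - f i z))\<^sup>2) \<longlonglongrightarrow> 0" by simp
      qed
      show "AE z in circle_measure. norm ((cmod (h z - f i z))\<^sup>2) \<le> (2 * B)\<^sup>2" for i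
      proof (rule AE_I2)
        fix z assume z: "z \<in> space circle_measure"
        have "cmod (h z) \<le> B"
          by (rule Lim_bounded[OF tendsto_norm[OF lim]]) (use B z in auto)
        moreover have "cmod (f i z) \<le> B" using B z by simp
        ultimately have "cmod (h z - f i z) \<le> 2 * B"
          using norm_triangle_ineq4[of "h z" "f i z"] by linarith
        then have "(cmod (h z - f i z))\<^sup>2 \<le> (2 * B)\<^sup>2" by (rule power_mono) simp
        then show "norm ((cmod (h z - f i z))\<^sup>2) \<le> (2 * B)\<^sup>2" by simp
      qed
    qed simp
    then have lim0: "(\<lambda>i. d h (f i)) \<longlonglongrightarrow> 0" by simp
    have "near h \<epsilon>" if "\<epsilon> > 0" for \<epsilon>
    proof -
      have "eventually (\<lambda>i. d h (f i) < \<epsilon> / 4) sequentially"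
        by (rule order_tendstoD(2)[OF lim0]) (use that in simp)
      then obtain i where i: "d h (f i) < \<epsilon> / 4" by (auto simp: eventually_sequentially)
      have "near (f i) (\<epsilon> / 4)" using f that by simp
      then obtain q r where q: "A q" "R r" "d (f i) (\<lambda>z. q z + r z) < \<epsilon> / 4" unfolding near_def by blast
      have "d h (\<lambda>z. q z + r z) < \<epsilon>"
        using d_triangle[of h "f i" "\<lambda>z. q z + r z"] h f AR_bdd[OF q(1,2)] i q(3) by fastforce
      then show ?thesis unfolding near_def using q by blast
    qed
    then show "circle_bounded h \<and> (\<forall>\<epsilon>>0. near h \<epsilon>)" using h by blast
  qed (use circle_bounded_bound in blast)
  have v_near: "near v \<epsilon>" if "\<epsilon> > 0" for \<epsilon>
  proof -
    obtain B where "\<forall>z\<in>sphere 0 1. cmod (v z) \<le> B" using circle_bounded_bound[OF v] by blast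
    then show ?thesis using bounded_measurable[OF circle_bounded_measurable[OF v], of B] that by blast
  qed
  define U where "U = (\<integral>z. (cmod (u z))\<^sup>2 \<partial>circle_measure)"
  have U: "U \<ge> 0" by (simp add: U_def)
  have small: "cmod (\<integral>z. z powi n * (u z * v z) \<partial>circle_measure) \<le> \<delta> * (U + 1)" if \<delta>: "\<delta> > 0" for \<delta>
  proof -
    have "near v (\<delta>\<^sup>2)" using v_near \<delta> by simp
    then obtain q r where q: "A q" "R r" and dv: "d v (\<lambda>z. q z + r z) < \<delta>\<^sup>2" unfolding near_def by blast
    have bq: "circle_bounded q" and br: "circle_bounded r" using q by (simp_all add: A_def R_def)
    define w where "w z = v z - q z" for z
    have w: "circle_bounded w" unfolding w_def by (intro circle_bounded_diff v bq)
    have "(\<integral>z. z powi m * w z \<partial>circle_measure) = 0" if "m > 0" for m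
      using v0[OF that] q(1) that by (simp add: w_def A_def right_diff_distrib int v bq)
    then have wr: "(\<integral>z. w z * cnj (r z) \<partial>circle_measure) = 0" using q(2) w by (simp add: R_def)
    have "(\<integral>z. (cmod (w z))\<^sup>2 \<partial>circle_measure) \<le>
        (\<integral>z. (cmod (w z))\<^sup>2 + (cmod (r z))\<^sup>2 - 2 * Re (w z * cnj (r z)) \<partial>circle_measure)"
    proof -
      have "integrable circle_measure (\<lambda>z. w z * cnj (r z))" by (intro int w br)
      moreover from integral_Re[OF this] wr
      have "(\<integral>z. Re (w z * cnj (r z)) \<partial>circle_measure) = 0" by simp
      ultimately show ?thesis
        by (simp add: integrable_circle_bounded_norm2 w br del: times_complex.sel)
    qed
    also have "\<dots> = d v (\<lambda>z. q z + r z)"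
      unfolding d_def
    proof (rule Bochner_Integration.integral_cong[OF refl])
      fix z
      have "v z - (q z + r z) = w z - r z" by (simp add: w_def)
      then show "(cmod (w z))\<^sup>2 + (cmod (r z))\<^sup>2 - 2 * Re (w z * cnj (r z)) = (cmod (v z - (q z + r z)))\<^sup>2"
        by (simp only: cmod_power2 minus_complex.sel times_complex.sel complex_cnj)
          (simp add: power2_eq_square algebra_simps)
    qed
    finally have wd: "(\<integral>z. (cmod (w z))\<^sup>2 \<partial>circle_measure) < \<delta>\<^sup>2" using dv by simp
    have "(\<integral>z. z powi n * (u z * v z) \<partial>circle_measure) =
        (\<integral>z. z powi n * (u z * w z) + z powi n * (u z * q z) \<partial>circle_measure)"
      by (rule Bochner_Integration.integral_cong) (simp_all add: w_def algebra_simps)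
    also have "\<dots> = (\<integral>z. z powi n * (u z * w z) \<partial>circle_measure)"
      using q(1) n by (simp add: umult w bq A_def)
    finally have "cmod (\<integral>z. z powi n * (u z * v z) \<partial>circle_measure) \<le>
        (\<integral>z. cmod (z powi n * (u z * w z)) \<partial>circle_measure)"
      using integral_norm_bound[of circle_measure "\<lambda>z. z powi n * (u z * w z)"] by simp
    also have "\<dots> \<le> (\<integral>z. \<delta> / 2 * (cmod (u z))\<^sup>2 + 1 / (2 * \<delta>) * (cmod (w z))\<^sup>2 \<partial>circle_measure)"
    proof (rule integral_mono)
      fix z assume "z \<in> space circle_measure"
      then have "cmod (z powi n) = 1" using norm_powi_circle[of z n] by simp
      then have "cmod (z powi n * (u z * w z)) = cmod (u z) * cmod (w z)" by (simp add: norm_mult)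
      also have "\<dots> \<le> \<delta> / 2 * (cmod (u z))\<^sup>2 + 1 / (2 * \<delta>) * (cmod (w z))\<^sup>2"
        using zero_le_power2[of "\<delta> * cmod (u z) - cmod (w z)"] \<delta>
        by (simp add: power2_eq_square field_simps)
      finally show "cmod (z powi n * (u z * w z)) \<le> \<delta> / 2 * (cmod (u z))\<^sup>2 + 1 / (2 * \<delta>) * (cmod (w z))\<^sup>2" .
    qed (use umult[OF w] u(2) w in \<open>auto intro!: Bochner_Integration.integrable_add integrable_mult_right
           integrable_norm integrable_circle_bounded_norm2\<close>)
    also have "\<dots> = \<delta> / 2 * U + 1 / (2 * \<delta>) * (\<integral>z. (cmod (w z))\<^sup>2 \<partial>circle_measure)"
      using u(2) integrable_circle_bounded_norm2[OF w] by (simp add: U_def)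
    also have "\<dots> \<le> \<delta> / 2 * U + 1 / (2 * \<delta>) * \<delta>\<^sup>2"
      using wd \<delta> by (intro add_left_mono mult_left_mono) auto
    also have "\<dots> \<le> \<delta> * (U + 1)"
      using \<delta> U by (simp add: power2_eq_square field_simps)
    finally show ?thesis .
  qed
  have "cmod (\<integral>z. z powi n * (u z * v z) \<partial>circle_measure) \<le> 0 + \<epsilon>" if "\<epsilon> > 0" for \<epsilon>
    using small[of "\<epsilon> / (U + 1)"] that U by simp
  then have "cmod (\<integral>z. z powi n * (u z * v z) \<partial>circle_measure) \<le> 0" by (rule field_le_epsilon)
  then show ?thesis by simp
qed


text \<open>
  A bound that holds almost everywhere is turned into one that holds on the whole circle by
  changing \<open>v\<close> on a null set.
\<close>
lemma hardy_product_AE: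
  assumes u: "u \<in> borel_measurable circle_measure" "integrable circle_measure (\<lambda>z. (cmod (u z))\<^sup>2)"
    and u0: "\<And>n. n > 0 \<Longrightarrow> (\<integral>z. z powi n * u z \<partial>circle_measure) = 0"
    and v: "v \<in> borel_measurable circle_measure" "AE z in circle_measure. cmod (v z) \<le> B"
    and v0: "\<And>n. n > 0 \<Longrightarrow> (\<integral>z. z powi n * v z \<partial>circle_measure) = 0"
    and n: "n > 0"
  shows "(\<integral>z. z powi n * (u z * v z) \<partial>circle_measure) = 0"
proof -
  define w where "w z = (if cmod (v z) \<le> B then v z else 0)" for z
  have w_meas: "w \<in> borel_measurable circle_measure" unfolding w_def using v(1) by measurable
  have w_ae: "AE z in circle_measure. w z = v z" using v(2) by eventually_elim (simp add: w_def)
  have w_bdd: "circle_bounded w"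
    by (rule circle_boundedI[OF w_meas, of "max 0 B"]) (auto simp: w_def)
  have w0: "(\<integral>z. z powi m * w z \<partial>circle_measure) = 0" if "m > 0" for m
  proof -
    have "(\<integral>z. z powi m * w z \<partial>circle_measure) = (\<integral>z. z powi m * v z \<partial>circle_measure)"
      by (rule integral_cong_AE) (use w_meas v(1) w_ae in auto)
    then show ?thesis using v0[OF that] by simp
  qed
  have "(\<integral>z. z powi n * (u z * v z) \<partial>circle_measure) = (\<integral>z. z powi n * (u z * w z) \<partial>circle_measure)"
    by (rule integral_cong_AE) (use u(1) w_meas v(1) w_ae in auto)
  also have "\<dots> = 0" by (rule hardy_product[OF u u0 w_bdd w0 n])
  finally show ?thesis .
qed


section \<open>Vector-valued functions on the circle\<close>

lemma borel_measurable_cinner [measurable]: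
  fixes f g :: "'a \<Rightarrow> 'h::findim_chilbert"
  assumes "f \<in> borel_measurable M" "g \<in> borel_measurable M"
  shows "(\<lambda>x. cinner (f x) (g x)) \<in> borel_measurable M"
  using assms
  by (rule borel_measurable_continuous_Pair)
    (intro bounded_bilinear.continuous_on[OF bounded_bilinear_cinner] continuous_intros)

lemma borel_measurable_scaleC [measurable]:
  fixes g :: "'a \<Rightarrow> 'h::findim_chilbert"
  assumes "f \<in> borel_measurable M" "g \<in> borel_measurable M"
  shows "(\<lambda>x. f x *\<^sub>C g x) \<in> borel_measurable M"
  using assms
  by (rule borel_measurable_continuous_Pair)
    (intro bounded_bilinear.continuous_on[OF bounded_bilinear_scaleC] continuous_intros)

lemma ae_eq_refl [simp]: "ae_eq f f"
  by (simp add: ae_eq_def)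

lemma ae_eq_sym: "ae_eq f g \<Longrightarrow> ae_eq g f"
  unfolding ae_eq_def by (elim eventually_mono) simp

lemma ae_eq_trans [trans]:
  assumes "ae_eq f g" "ae_eq g h"
  shows "ae_eq f h"
  using assms unfolding ae_eq_def by eventually_elim simp

lemma L2_measurable [measurable_dest]: "f \<in> L2 \<Longrightarrow> f \<in> borel_measurable circle_measure"
  by (simp add: L2_def)

lemma L2_dominated:
  fixes g :: "complex \<Rightarrow> 'h::findim_chilbert" and f :: "complex \<Rightarrow> 'k::findim_chilbert"
  assumes g: "g \<in> borel_measurable circle_measure" and f: "f \<in> L2"
    and le: "AE z in circle_measure. norm (g z) \<le> K * norm (f z)"
  shows "g \<in> L2"
proof -
  have "integrable circle_measure (\<lambda>z. (norm (g z))\<^sup>2)"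
  proof (rule Bochner_Integration.integrable_bound)
    show "integrable circle_measure (\<lambda>z. K\<^sup>2 * (norm (f z))\<^sup>2)" using f by (simp add: L2_def)
    show "(\<lambda>z. (norm (g z))\<^sup>2) \<in> borel_measurable circle_measure" using g by measurable
    show "AE z in circle_measure. norm ((norm (g z))\<^sup>2) \<le> norm (K\<^sup>2 * (norm (f z))\<^sup>2)"
      using le
    proof eventually_elim
      case (elim z)
      then show ?case using power_mono[OF elim norm_ge_zero, of 2] by (simp add: power_mult_distrib)
    qed
  qed
  then show ?thesis using g by (simp add: L2_def)
qed

lemma L2_integrable: "f \<in> L2 \<Longrightarrow> integrable circle_measure f"
  by (rule integrable_if_norm2) (simp_all add: L2_def)

lemma L2_const: "(\<lambda>z. x) \<in> L2"
  by (simp add: L2_def)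

lemma L2_scaleC: "f \<in> L2 \<Longrightarrow> (\<lambda>z. c *\<^sub>C f z) \<in> L2"
  by (rule L2_dominated[where K = "cmod c"]) (auto simp: norm_scaleC)

lemma L2_powi: "f \<in> L2 \<Longrightarrow> (\<lambda>z. z powi n *\<^sub>C f z) \<in> L2"
  by (rule L2_dominated[where K = 1]) (auto simp: norm_scaleC norm_power_int intro!: AE_I2)

lemma L2_ae_eq: "f \<in> L2 \<Longrightarrow> g \<in> borel_measurable circle_measure \<Longrightarrow> ae_eq f g \<Longrightarrow> g \<in> L2"
  by (rule L2_dominated[where K = 1]) (auto simp: ae_eq_def elim: eventually_mono)

lemma L2_cinner:
  "f \<in> L2 \<Longrightarrow> (\<lambda>z. cinner (f z) y) \<in> L2"
  by (rule L2_dominated[where K = "norm y"])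
    (auto intro!: AE_I2 order_trans[OF cinner_norm_le] simp: mult.commute)

lemma L2_add:
  assumes "f \<in> L2" "g \<in> L2"
  shows "(\<lambda>z. f z + g z) \<in> L2"
proof -
  have int: "integrable circle_measure (\<lambda>z. 2 * (norm (f z))\<^sup>2 + 2 * (norm (g z))\<^sup>2)"
    using assms by (simp add: L2_def)
  have meas: "(\<lambda>z. (norm (f z + g z))\<^sup>2) \<in> borel_measurable circle_measure"
    using assms by measurable
  have le: "(norm (f z + g z))\<^sup>2 \<le> 2 * (norm (f z))\<^sup>2 + 2 * (norm (g z))\<^sup>2" for z
    using power_mono[OF norm_triangle_ineq[of "f z" "g z"], of 2]
      zero_le_power2[of "norm (f z) - norm (g z)"]
    by (simp add: power2_sum power2_diff)
  have "integrable circle_measure (\<lambda>z. (norm (f z + g z))\<^sup>2)"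
    by (rule Bochner_Integration.integrable_bound[OF int meas]) (intro AE_I2, simp add: le)
  moreover have "(\<lambda>z. f z + g z) \<in> borel_measurable circle_measure" using assms by measurable
  ultimately show ?thesis by (simp add: L2_def)
qed

lemma L2_cinner_integrable:
  fixes f g :: "complex \<Rightarrow> 'h::findim_chilbert"
  assumes "f \<in> L2" "g \<in> L2"
  shows "integrable circle_measure (\<lambda>z. cinner (f z) (g z))"
proof (rule Bochner_Integration.integrable_bound)
  show "integrable circle_measure (\<lambda>z. (norm (f z))\<^sup>2 + (norm (g z))\<^sup>2)" using assms by (simp add: L2_def)
  have "cmod (cinner (f z) (g z)) \<le> (norm (f z))\<^sup>2 + (norm (g z))\<^sup>2" for z
    using cinner_norm_le[of "f z" "g z"] zero_le_power2[of "norm (f z) - norm (g z)"]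
      zero_le_power2[of "norm (f z)"] zero_le_power2[of "norm (g z)"]
    unfolding power2_diff by linarith
  then show "AE z in circle_measure. norm (cinner (f z) (g z)) \<le> norm ((norm (f z))\<^sup>2 + (norm (g z))\<^sup>2)"
    by (intro AE_I2) simp
qed (use assms in measurable)

lemma cinner_fourier_coeff:
  fixes f :: "complex \<Rightarrow> 'h::findim_chilbert"
  assumes "f \<in> L2"
  shows "cinner (fourier_coeff f n) y = (\<integral>z. z powi (- n) * cinner (f z) y \<partial>circle_measure)"
proof -
  have "bounded_linear (\<lambda>x::'h. cinner x y)"
    by (rule bounded_bilinear.bounded_linear_left[OF bounded_bilinear_cinner])
  from integral_bounded_linear[OF this L2_integrable[OF L2_powi[OF assms, of "- n"]]]
  show ?thesis by (simp add: fourier_coeff_def cinner_scaleC_left)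
qed

text \<open>
  Scalar coefficients reduce questions about \<open>H\<^sup>2\<close> to the scalar results above.  The sign of \<open>n\<close> is
  reversed, because the coefficient of index \<open>-n\<close> is the integral against \<open>z\<^sup>n\<close>.
\<close>
lemma H2_iff_cinner:
  "f \<in> H2 \<longleftrightarrow> f \<in> L2 \<and> (\<forall>n>0. \<forall>y. (\<integral>z. z powi n * cinner (f z) y \<partial>circle_measure) = 0)"
proof -
  have *: "(\<forall>n<0. fourier_coeff f n = 0) \<longleftrightarrow> (\<forall>n>0. fourier_coeff f (- n) = 0)"
    by (metis neg_0_less_iff_less neg_less_0_iff_less minus_minus)
  have "fourier_coeff f (- n) = 0 \<longleftrightarrow> (\<forall>y. (\<integral>z. z powi n * cinner (f z) y \<partial>circle_measure) = 0)"
    if "f \<in> L2" for n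
    using cinner_fourier_coeff[OF that, of "- n"] cinner_extensionality[of "fourier_coeff f (- n)" 0]
    by auto
  then show ?thesis unfolding H2_def mem_Collect_eq * by blast
qed

lemma H2_L2: "f \<in> H2 \<Longrightarrow> f \<in> L2"
  by (simp add: H2_def)

lemma H2_ae_eq:
  fixes f g :: "complex \<Rightarrow> 'h::findim_chilbert"
  assumes f: "f \<in> H2" and g: "g \<in> borel_measurable circle_measure" and ae: "ae_eq f g"
  shows "g \<in> H2"
proof -
  have "(\<integral>z. z powi n * cinner (g z) y \<partial>circle_measure) = (\<integral>z. z powi n * cinner (f z) y \<partial>circle_measure)" for n y
    using ae H2_L2[OF f] g by (intro integral_cong_AE) (auto simp: ae_eq_def elim: eventually_mono)
  then show ?thesis using f L2_ae_eq[OF H2_L2[OF f] g ae] by (simp add: H2_iff_cinner)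
qed

lemma H2_const: "(\<lambda>z. x) \<in> H2"
  by (simp add: H2_iff_cinner L2_const integral_powi_circle)

lemma H2_add:
  fixes f g :: "complex \<Rightarrow> 'h::findim_chilbert"
  assumes "f \<in> H2" "g \<in> H2"
  shows "(\<lambda>z. f z + g z) \<in> H2"
proof -
  have "integrable circle_measure (\<lambda>z. z powi n * cinner (h z) y)" if "h \<in> L2" for h :: "complex \<Rightarrow> 'h" and n y
    using L2_cinner_integrable[OF L2_powi[OF that, of n] L2_const[of y]]
    by (simp add: cinner_scaleC_left)
  then show ?thesis
    using assms by (simp add: H2_iff_cinner L2_add cinner_add_left distrib_left)
qed

lemma H2_scaleC: "f \<in> H2 \<Longrightarrow> (\<lambda>z. c *\<^sub>C f z) \<in> H2"
  by (simp add: H2_iff_cinner L2_scaleC cinner_scaleC_left mult.left_commute[of _ c])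

lemma H2_sum: "(\<And>i. i \<in> I \<Longrightarrow> f i \<in> H2) \<Longrightarrow> (\<lambda>z. \<Sum>i\<in>I. f i z) \<in> H2"
  by (induction I rule: infinite_finite_induct) (auto simp: H2_const intro: H2_add)


section \<open>Unitary-valued functions and inner functions\<close>

text \<open>
  Unlike inner functions, these are closed under adjoints.  Linearity is required at every point of
  the circle, as in the definition of \<^const>\<open>Linf_op\<close>, and unitarity only almost everywhere.
\<close>
definition unitary_field :: "(complex \<Rightarrow> 'h::findim_chilbert \<Rightarrow> 'h) \<Rightarrow> bool" where
  "unitary_field F \<longleftrightarrow> (\<forall>z\<in>sphere 0 1. bounded_clinear (F z)) \<and>
     (\<forall>x. (\<lambda>z. F z x) \<in> borel_measurable circle_measure) \<and>
     (AE z in circle_measure. unitary_op (F z))"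

lemma unitary_fieldD:
  assumes "unitary_field F"
  shows "\<And>z. z \<in> sphere 0 1 \<Longrightarrow> bounded_clinear (F z)"
    "\<And>x. (\<lambda>z. F z x) \<in> borel_measurable circle_measure"
    "AE z in circle_measure. unitary_op (F z)"
  using assms by (auto simp: unitary_field_def)

lemma mult_op_measurable:
  fixes F :: "complex \<Rightarrow> 'h::findim_chilbert \<Rightarrow> 'h"
  assumes lin: "\<And>z. z \<in> sphere 0 1 \<Longrightarrow> bounded_clinear (F z)"
    and meas: "\<And>x. (\<lambda>z. F z x) \<in> borel_measurable circle_measure"
    and f: "f \<in> borel_measurable circle_measure"
  shows "mult_op F f \<in> borel_measurable circle_measure"
proof -
  have "(\<lambda>z. \<Sum>e\<in>onb. cinner (f z) e *\<^sub>C F z e) \<in> borel_measurable circle_measure"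
    using meas f by measurable
  moreover have "mult_op F f z = (\<Sum>e\<in>onb. cinner (f z) e *\<^sub>C F z e)" if "z \<in> space circle_measure" for z
    using that lin[of z] bounded_clinear_expansion[of "F z" "f z"] by (simp add: mult_op_def)
  ultimately show ?thesis by (rule measurable_cong[THEN iffD2, rotated])
qed

lemma unitary_field_mult_L2:
  assumes F: "unitary_field F" and f: "f \<in> L2"
  shows "mult_op F f \<in> L2"
proof (rule L2_dominated[OF _ f, of _ 1])
  show "mult_op F f \<in> borel_measurable circle_measure"
    by (rule mult_op_measurable) (use unitary_fieldD[OF F] f in auto)
  show "AE z in circle_measure. norm (mult_op F f z) \<le> 1 * norm (f z)"
    using unitary_fieldD(3)[OF F] by eventually_elim (simp add: mult_op_def unitary_norm)
qed

lemma unitary_field_const_L2: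
  assumes "unitary_field F"
  shows "(\<lambda>z. F z x) \<in> L2"
  using unitary_field_mult_L2[OF assms L2_const, of x] by (simp add: mult_op_def[abs_def])

lemma unitary_field_adj:
  fixes F :: "complex \<Rightarrow> 'h::findim_chilbert \<Rightarrow> 'h"
  assumes F: "unitary_field F"
  shows "unitary_field (adj_op F)"
  unfolding unitary_field_def
proof (intro conjI ballI allI)
  note D = unitary_fieldD[OF F]
  show "bounded_clinear (adj_op F z)" if "z \<in> sphere 0 1" for z
    using D(1)[OF that] by (simp add: adj_op_def bounded_clinear_cadjoint)
  show "(\<lambda>z. adj_op F z x) \<in> borel_measurable circle_measure" for x
  proof -
    have "(\<lambda>z. \<Sum>e\<in>onb. cinner x (F z e) *\<^sub>C e) \<in> borel_measurable circle_measure"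
      using D(2) by measurable
    moreover have "adj_op F z x = (\<Sum>e\<in>onb. cinner x (F z e) *\<^sub>C e)" if "z \<in> space circle_measure" for z
      using that D(1)[of z] cadjoint_expansion(1)[of "F z" x] by (simp add: adj_op_def)
    ultimately show ?thesis by (rule measurable_cong[THEN iffD2, rotated])
  qed
  show "AE z in circle_measure. unitary_op (adj_op F z)"
    using D(3) by eventually_elim (simp add: adj_op_def unitary_cadjoint)
qed

lemma unitary_field_prod:
  fixes F G :: "complex \<Rightarrow> 'h::findim_chilbert \<Rightarrow> 'h"
  assumes F: "unitary_field F" and G: "unitary_field G"
  shows "unitary_field (F \<odot> G)"
  unfolding unitary_field_def
proof (intro conjI ballI allI)
  show "bounded_clinear ((F \<odot> G) z)" if "z \<in> sphere 0 1" for z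
    using unitary_fieldD(1)[OF F that] unitary_fieldD(1)[OF G that]
    by (simp add: prod_op_def bounded_clinear_comp)
  show "(\<lambda>z. (F \<odot> G) z x) \<in> borel_measurable circle_measure" for x
    using mult_op_measurable[OF unitary_fieldD(1,2)[OF F] unitary_fieldD(2)[OF G, of x]]
    by (simp add: mult_op_def[abs_def] prod_op_def)
  show "AE z in circle_measure. unitary_op ((F \<odot> G) z)"
    using unitary_fieldD(3)[OF F] unitary_fieldD(3)[OF G]
    by eventually_elim (simp add: prod_op_def unitary_comp)
qed

lemma conjugation_measurable:
  fixes J :: "'h::findim_chilbert \<Rightarrow> 'h"
  assumes "conjugation J"
  shows "J \<in> borel_measurable borel"
  by (intro borel_measurable_continuous_onI linear_continuous_on conjugation_bounded_linear assms)

lemma unitary_field_conj: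
  fixes F :: "complex \<Rightarrow> 'h::findim_chilbert \<Rightarrow> 'h"
  assumes J: "conjugation J" and F: "unitary_field F"
  shows "unitary_field (conj_op J F)"
  unfolding unitary_field_def
proof (intro conjI ballI allI)
  show "bounded_clinear (conj_op J F z)" if "z \<in> sphere 0 1" for z
    using unitary_fieldD(1)[OF F, of "cnj z"] that
    by (simp add: conj_op_def bounded_clinear_conj[OF J])
  show "(\<lambda>z. conj_op J F z x) \<in> borel_measurable circle_measure" for x
    unfolding conj_op_def o_def
    by (rule measurable_compose[OF measurable_compose[OF measurable_cnj_circle unitary_fieldD(2)[OF F, of "J x"]]
          conjugation_measurable[OF J]])
  show "AE z in circle_measure. unitary_op (conj_op J F z)"
    using AE_cnj[OF unitary_fieldD(3)[OF F]]
    by eventually_elim (simp add: conj_op_def unitary_conj[OF J])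
qed

text \<open>
  Unitarity already bounds the norm by \<open>1\<close>, so what distinguishes inner functions is that their
  columns lie in \<open>H\<^sup>2\<close>.
\<close>
lemma inner_function_iff:
  "inner_function F \<longleftrightarrow> unitary_field F \<and> (\<forall>x. (\<lambda>z. F z x) \<in> H2)"
proof -
  have "\<exists>c. AE z in circle_measure. onorm (F z) \<le> c" if "AE z in circle_measure. unitary_op (F z)"
  proof (intro exI)
    show "AE z in circle_measure. onorm (F z) \<le> 1"
      using that by eventually_elim (rule onorm_bound, simp_all add: unitary_norm)
  qed
  then have "inner_function F \<longleftrightarrow>
      unitary_field F \<and> (\<forall>x. \<forall>n<0. fourier_coeff (\<lambda>z. F z x) n = 0)"
    by (auto simp: inner_function_def Hinf_op_def Linf_op_def unitary_field_def
        fourier_coeff_op_def fun_eq_iff)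
  then show ?thesis using unitary_field_const_L2[of F] by (auto simp: H2_def)
qed

lemma inner_function_unitary_field: "inner_function F \<Longrightarrow> unitary_field F"
  by (simp add: inner_function_iff)

text \<open>
  In an orthonormal basis each component of \<open>F h\<close> is a finite sum of products of a component of
  \<open>h\<close>, which is square-integrable, and an entry of \<open>F\<close>, which is bounded.
\<close>
lemma inner_mult_H2:
  fixes F :: "complex \<Rightarrow> 'h::findim_chilbert \<Rightarrow> 'h"
  assumes F: "inner_function F" and h: "h \<in> H2"
  shows "mult_op F h \<in> H2"
proof -
  note U = inner_function_unitary_field[OF F]
  have FH: "(\<lambda>z. F z x) \<in> H2" for x using F by (simp add: inner_function_iff)
  have "(\<integral>z. z powi n * cinner (mult_op F h z) y \<partial>circle_measure) = 0" if n: "n > 0" for n y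
  proof -
    have hc: "(\<lambda>z. cinner (h z) e) \<in> L2" for e by (rule L2_cinner[OF H2_L2[OF h]])
    have Fb: "AE z in circle_measure. cmod (cinner (F z e) y) \<le> norm e * norm y" for e
      using unitary_fieldD(3)[OF U]
    proof eventually_elim
      case (elim z)
      then show ?case using cinner_norm_le[of "F z e" y] by (simp add: unitary_norm)
    qed
    have coeff0: "(\<integral>z. z powi n * (cinner (h z) e * cinner (F z e) y) \<partial>circle_measure) = 0" for e
      using hc[of e] h FH[of e] H2_L2[OF FH[of e]] L2_cinner[OF H2_L2[OF FH[of e]], of y]
      by (intro hardy_product_AE[OF _ _ _ _ Fb _ n]) (auto simp: H2_iff_cinner L2_def)
    have int: "integrable circle_measure (\<lambda>z. z powi n * (cinner (h z) e * cinner (F z e) y))" for e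
    proof -
      have "(\<lambda>z. mult_op F (\<lambda>z. cinner (h z) e *\<^sub>C e) z) \<in> L2"
        by (intro unitary_field_mult_L2[OF U] L2_dominated[OF _ hc[of e], where K = "norm e"])
          (use H2_L2[OF h] in \<open>auto simp: norm_scaleC mult.commute\<close>)
      note Fh = L2_cinner_integrable[OF L2_powi[OF this, of n] L2_const[of y]]
      have "cinner (z powi n *\<^sub>C mult_op F (\<lambda>z. cinner (h z) e *\<^sub>C e) z) y =
          z powi n * (cinner (h z) e * cinner (F z e) y)" if "z \<in> space circle_measure" for z
        using that unitary_fieldD(1)[OF U, of z]
        by (simp add: mult_op_def bounded_clinear_simps cinner_scaleC_left)
      then show ?thesis using Fh Bochner_Integration.integrable_cong[OF refl] by (metis (no_types, lifting))
    qed
    have "(\<integral>z. z powi n * cinner (mult_op F h z) y \<partial>circle_measure) =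
        (\<integral>z. (\<Sum>e\<in>onb. z powi n * (cinner (h z) e * cinner (F z e) y)) \<partial>circle_measure)"
    proof (rule Bochner_Integration.integral_cong[OF refl])
      fix z assume "z \<in> space circle_measure"
      then have "bounded_clinear (F z)" using unitary_fieldD(1)[OF U, of z] by simp
      from bounded_clinear_expansion[OF this, of "h z"]
      show "z powi n * cinner (mult_op F h z) y = (\<Sum>e\<in>onb. z powi n * (cinner (h z) e * cinner (F z e) y))"
        by (simp add: mult_op_def cinner_sum_left cinner_scaleC_left sum_distrib_left)
    qed
    also have "\<dots> = 0" by (simp add: Bochner_Integration.integral_sum int coeff0)
    finally show ?thesis .
  qed
  then show ?thesis using unitary_field_mult_L2[OF U H2_L2[OF h]] by (simp add: H2_iff_cinner)
qed

lemma J_star_L2: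
  fixes f :: "complex \<Rightarrow> 'h::findim_chilbert"
  assumes J: "conjugation J" and f: "f \<in> L2"
  shows "J_star J f \<in> L2"
proof -
  have fc: "(\<lambda>z. f (cnj z)) \<in> borel_measurable circle_measure"
    using f measurable_compose[OF measurable_cnj_circle] by (auto simp: L2_def)
  have "integrable circle_measure (\<lambda>z. (norm (f (cnj z)))\<^sup>2)"
    using integrable_cnj_circle[of "\<lambda>z. (norm (f z))\<^sup>2"] f by (simp add: L2_def)
  then show ?thesis
    using measurable_compose[OF fc conjugation_measurable[OF J]]
    by (simp add: L2_def J_star_def[abs_def] conjugation_norm[OF J])
qed

text \<open>
  Reflection of the circle reverses the indices of Fourier coefficients, and antilinearity of \<open>J\<close>
  reverses them again.
\<close>
lemma J_star_H2:
  fixes f :: "complex \<Rightarrow> 'h::findim_chilbert"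
  assumes J: "conjugation J" and f: "f \<in> H2"
  shows "J_star J f \<in> H2"
proof -
  have "(\<integral>z. z powi n * cinner (J_star J f z) y \<partial>circle_measure) = 0" if n: "n > 0" for n y
  proof -
    define g where "g z = z powi n * cinner (J_star J f z) y" for z
    have "g \<in> borel_measurable circle_measure"
      unfolding g_def using J_star_L2[OF J H2_L2[OF f]] by measurable
    then have "(\<integral>z. g z \<partial>circle_measure) = (\<integral>z. g (cnj z) \<partial>circle_measure)"
      by (rule integral_cnj_circle[symmetric])
    also have "\<dots> = (\<integral>z. cnj (z powi n * cinner (f z) (J y)) \<partial>circle_measure)"
    proof (rule Bochner_Integration.integral_cong[OF refl])
      fix z
      have "cinner (J (f z)) y = cnj (cinner (f z) (J y))"
        using conjugation_cinner_swap[OF J, of "f z" y] by simp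
      then show "g (cnj z) = cnj (z powi n * cinner (f z) (J y))"
        by (simp add: g_def J_star_def del: cnj_cinner)
    qed
    also have "\<dots> = 0" using f n by (simp add: H2_iff_cinner del: complex_cnj_mult)
    finally show ?thesis by (simp add: g_def)
  qed
  then show ?thesis using J_star_L2[OF J H2_L2[OF f]] by (simp add: H2_iff_cinner)
qed

lemma inner_function_conj:
  fixes F :: "complex \<Rightarrow> 'h::findim_chilbert \<Rightarrow> 'h"
  assumes J: "conjugation J" and F: "inner_function F"
  shows "inner_function (conj_op J F)"
proof -
  have "(\<lambda>z. conj_op J F z x) = J_star J (\<lambda>z. F z (J x))" for x
    by (simp add: fun_eq_iff conj_op_def J_star_def)
  then show ?thesis
    using F unitary_field_conj[OF J] J_star_H2[OF J] by (simp add: inner_function_iff)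
qed


section \<open>The conjugations \<open>C\<^sub>J\<close>\<close>

lemma C_J_apply: "C_J J \<Lambda> \<Gamma> f z = \<Gamma> z (J (cadjoint (\<Lambda> (cnj z)) (f (cnj z))))"
  by (simp add: C_J_def mult_op_def J_star_def adj_op_def)

lemma C_J_L2:
  fixes \<Lambda> \<Gamma> :: "complex \<Rightarrow> 'h::findim_chilbert \<Rightarrow> 'h"
  assumes "conjugation J" "unitary_field \<Lambda>" "unitary_field \<Gamma>" "f \<in> L2"
  shows "C_J J \<Lambda> \<Gamma> f \<in> L2"
  using assms by (simp add: C_J_def unitary_field_mult_L2 J_star_L2 unitary_field_adj)

lemma C_J_cong: "ae_eq f g \<Longrightarrow> ae_eq (C_J J \<Lambda> \<Gamma> f) (C_J J \<Lambda> \<Gamma> g)"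
  unfolding ae_eq_def by (drule AE_cnj, elim eventually_mono) (simp add: C_J_apply)

lemma L2_inner_cong:
  assumes "f \<in> L2" "f' \<in> L2" "g \<in> L2" "g' \<in> L2" "ae_eq f f'" "ae_eq g g'"
  shows "L2_inner f g = L2_inner f' g'"
proof -
  have "AE z in circle_measure. cinner (f z) (g z) = cinner (f' z) (g' z)"
    using assms(5,6) unfolding ae_eq_def by eventually_elim simp
  then show ?thesis
    unfolding L2_inner_def using assms(1-4) by (intro integral_cong_AE) auto
qed

text \<open>
  With \<open>A, B\<close> the values of \<open>\<Gamma>, \<Lambda>\<close> at \<open>z\<close> and \<open>A', B'\<close> their values at the
  conjugate of \<open>z\<close>, the left-hand side is the equation \<open>\<Gamma> \<Lambda>\<^sub>J\<^sup>* = \<Lambda> \<Gamma>\<^sub>J\<^sup>*\<close> at \<open>z\<close>, and the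
  right-hand side says that \<open>C\<^sub>J\<close> squares to the identity there.  Each follows from the other by
  multiplying with the inverse \<open>J A'\<^sup>* J\<close> of \<open>J A' J\<close> and the inverse \<open>B\<^sup>*\<close> of \<open>B\<close>.
\<close>
lemma intertwining_iff_involutive:
  fixes A B A' B' :: "'h::findim_chilbert \<Rightarrow> 'h"
  assumes J: "conjugation J" and A': "unitary_op A'" and B: "unitary_op B"
  shows "(\<forall>x. A (J (cadjoint B' (J x))) = B (J (cadjoint A' (J x)))) \<longleftrightarrow>
    (\<forall>y. A (J (cadjoint B' (A' (J (cadjoint B y))))) = y)" (is "?l \<longleftrightarrow> ?r")
proof
  assume l: ?l
  show ?r
  proof
    fix y
    show "A (J (cadjoint B' (A' (J (cadjoint B y))))) = y"
      using l[rule_format, of "J (A' (J (cadjoint B y)))"]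
      by (simp add: conjugationD(3)[OF J] unitary_opD(2,3)[OF A'] unitary_opD(2,3)[OF B])
  qed
next
  assume r: ?r
  show ?l
  proof
    fix x
    show "A (J (cadjoint B' (J x))) = B (J (cadjoint A' (J x)))"
      using r[rule_format, of "B (J (cadjoint A' (J x)))"]
      by (simp add: conjugationD(3)[OF J] unitary_opD(2,3)[OF A'] unitary_opD(2,3)[OF B])
  qed
qed

lemma symbol_equation_iff:
  fixes \<Lambda> \<Gamma> :: "complex \<Rightarrow> 'h::findim_chilbert \<Rightarrow> 'h"
  assumes J: "conjugation J" and L: "unitary_field \<Lambda>" and G: "unitary_field \<Gamma>"
  shows "ae_eq (\<Gamma> \<odot> adj_op (conj_op J \<Lambda>)) (\<Lambda> \<odot> adj_op (conj_op J \<Gamma>)) \<longleftrightarrow>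
    (AE z in circle_measure.
      \<forall>y. \<Gamma> z (J (cadjoint (\<Lambda> (cnj z)) (\<Gamma> (cnj z) (J (cadjoint (\<Lambda> z) y))))) = y)"
proof -
  have "AE z in circle_measure.
      (\<Gamma> \<odot> adj_op (conj_op J \<Lambda>)) z = (\<Lambda> \<odot> adj_op (conj_op J \<Gamma>)) z \<longleftrightarrow>
      (\<forall>y. \<Gamma> z (J (cadjoint (\<Lambda> (cnj z)) (\<Gamma> (cnj z) (J (cadjoint (\<Lambda> z) y))))) = y)"
    using unitary_fieldD(3)[OF L] AE_cnj[OF unitary_fieldD(3)[OF L]] AE_cnj[OF unitary_fieldD(3)[OF G]]
  proof eventually_elim
    case (elim z)
    have "(\<Gamma> \<odot> adj_op (conj_op J \<Lambda>)) z = (\<Lambda> \<odot> adj_op (conj_op J \<Gamma>)) z \<longleftrightarrow>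
        (\<forall>x. \<Gamma> z (J (cadjoint (\<Lambda> (cnj z)) (J x))) = \<Lambda> z (J (cadjoint (\<Gamma> (cnj z)) (J x))))"
      by (simp add: prod_op_def adj_op_def conj_op_def cadjoint_conj[OF J] unitary_opD(1)[OF elim(2)]
          unitary_opD(1)[OF elim(3)] fun_eq_iff)
    then show ?case
      by (simp only: intertwining_iff_involutive[OF J elim(3) elim(1)])
  qed
  then show ?thesis
    unfolding ae_eq_def by (rule eventually_subst)
qed

lemma C_J_isometric:
  fixes \<Lambda> \<Gamma> :: "complex \<Rightarrow> 'h::findim_chilbert \<Rightarrow> 'h"
  assumes J: "conjugation J" and L: "unitary_field \<Lambda>" and G: "unitary_field \<Gamma>"
    and f: "f \<in> L2" and g: "g \<in> L2"
  shows "L2_inner (C_J J \<Lambda> \<Gamma> f) (C_J J \<Lambda> \<Gamma> g) = L2_inner g f"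
proof -
  define k where "k z = cinner (g z) (f z)" for z
  have k: "k \<in> borel_measurable circle_measure" unfolding k_def using f g by measurable
  have "(\<lambda>z. k (cnj z)) \<in> borel_measurable circle_measure"
    by (rule measurable_compose[OF measurable_cnj_circle k])
  moreover have "AE z in circle_measure. cinner (C_J J \<Lambda> \<Gamma> f z) (C_J J \<Lambda> \<Gamma> g z) = k (cnj z)"
    using unitary_fieldD(3)[OF G] AE_cnj[OF unitary_fieldD(3)[OF L]]
    by eventually_elim
      (simp add: C_J_apply unitary_cinner unitary_cadjoint conjugationD(4)[OF J] k_def)
  ultimately have "L2_inner (C_J J \<Lambda> \<Gamma> f) (C_J J \<Lambda> \<Gamma> g) = (\<integral>z. k (cnj z) \<partial>circle_measure)"
    unfolding L2_inner_def using C_J_L2[OF J L G f] C_J_L2[OF J L G g]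
    by (intro integral_cong_AE) auto
  then show ?thesis using integral_cnj_circle[OF k] by (simp add: L2_inner_def k_def)
qed

lemma C_J_conjugation:
  fixes \<Lambda> \<Gamma> :: "complex \<Rightarrow> 'h::findim_chilbert \<Rightarrow> 'h"
  assumes J: "conjugation J" and L: "unitary_field \<Lambda>" and G: "unitary_field \<Gamma>"
    and inv: "AE z in circle_measure.
      \<forall>y. \<Gamma> z (J (cadjoint (\<Lambda> (cnj z)) (\<Gamma> (cnj z) (J (cadjoint (\<Lambda> z) y))))) = y"
  shows "L2_conjugation (C_J J \<Lambda> \<Gamma>)"
proof -
  have lin: "bounded_clinear (\<Gamma> z)" "bounded_clinear (cadjoint (\<Lambda> (cnj z)))"
    if "z \<in> space circle_measure" for z
    using that unitary_fieldD(1)[OF G, of z] unitary_fieldD(1)[OF L, of "cnj z"]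
    by (simp_all add: bounded_clinear_cadjoint)
  have "ae_eq (C_J J \<Lambda> \<Gamma> (\<lambda>z. f z + g z)) (\<lambda>z. C_J J \<Lambda> \<Gamma> f z + C_J J \<Lambda> \<Gamma> g z)" for f g
    unfolding ae_eq_def
    by (rule AE_I2) (simp only: C_J_apply bounded_clinear_simps lin conjugationD[OF J])
  moreover have "ae_eq (C_J J \<Lambda> \<Gamma> (\<lambda>z. c *\<^sub>C f z)) (\<lambda>z. cnj c *\<^sub>C C_J J \<Lambda> \<Gamma> f z)" for c f
    unfolding ae_eq_def
    by (rule AE_I2) (simp only: C_J_apply bounded_clinear_simps lin conjugationD[OF J])
  moreover have "ae_eq (C_J J \<Lambda> \<Gamma> (C_J J \<Lambda> \<Gamma> f)) f" for f
    unfolding ae_eq_def using inv by eventually_elim (simp add: C_J_apply)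
  ultimately show ?thesis
    using C_J_L2[OF J L G] C_J_cong[of _ _ J \<Lambda> \<Gamma>] C_J_isometric[OF J L G]
    unfolding L2_conjugation_def by blast
qed

lemma C_J_shift:
  fixes \<Lambda> \<Gamma> :: "complex \<Rightarrow> 'h::findim_chilbert \<Rightarrow> 'h"
  assumes J: "conjugation J" and L: "unitary_field \<Lambda>" and G: "unitary_field \<Gamma>"
  shows "ae_eq (C_J J \<Lambda> \<Gamma> (shift_op f)) (shift_op (C_J J \<Lambda> \<Gamma> f))"
  unfolding ae_eq_def
proof (rule AE_I2)
  fix z assume "z \<in> space circle_measure"
  then have "bounded_clinear (\<Gamma> z)" "bounded_clinear (cadjoint (\<Lambda> (cnj z)))"
    using unitary_fieldD(1)[OF G, of z] unitary_fieldD(1)[OF L, of "cnj z"]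
    by (simp_all add: bounded_clinear_cadjoint)
  then show "C_J J \<Lambda> \<Gamma> (shift_op f) z = shift_op (C_J J \<Lambda> \<Gamma> f) z"
    by (simp add: C_J_apply shift_op_def bounded_clinear_simps conjugationD[OF J])
qed

text \<open>
  For \<open>\<Gamma> = \<Theta> \<Phi>\<close> an element \<open>\<Lambda> h\<close> is mapped to \<open>\<Theta> \<Phi> J\<^sup>\<star> h\<close>, and both \<open>J\<^sup>\<star>\<close> and an inner
  \<open>\<Phi>\<close> preserve \<open>H\<^sup>2\<close>.
\<close>
lemma C_J_maps_into:
  fixes \<Theta> \<Lambda> \<Phi> :: "complex \<Rightarrow> 'h::findim_chilbert \<Rightarrow> 'h"
  assumes J: "conjugation J" and L: "unitary_field \<Lambda>" and T: "unitary_field \<Theta>"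
    and P: "inner_function \<Phi>" and g: "g \<in> mult_H2 \<Lambda>"
  shows "C_J J \<Lambda> (\<Theta> \<odot> \<Phi>) g \<in> mult_H2 \<Theta>"
proof -
  obtain h where h: "h \<in> H2" "ae_eq g (mult_op \<Lambda> h)" and gL: "g \<in> L2"
    using g by (auto simp: mult_H2_def)
  have "ae_eq (C_J J \<Lambda> (\<Theta> \<odot> \<Phi>) g) (C_J J \<Lambda> (\<Theta> \<odot> \<Phi>) (mult_op \<Lambda> h))"
    by (rule C_J_cong[OF h(2)])
  also have "ae_eq \<dots> (mult_op \<Theta> (mult_op \<Phi> (J_star J h)))"
    unfolding ae_eq_def using AE_cnj[OF unitary_fieldD(3)[OF L]]
    by eventually_elim (simp add: C_J_apply mult_op_def J_star_def prod_op_def unitary_opD)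
  finally have "ae_eq (C_J J \<Lambda> (\<Theta> \<odot> \<Phi>) g) (mult_op \<Theta> (mult_op \<Phi> (J_star J h)))" .
  moreover have "mult_op \<Phi> (J_star J h) \<in> H2"
    by (intro inner_mult_H2 P J_star_H2 J h)
  moreover have "C_J J \<Lambda> (\<Theta> \<odot> \<Phi>) g \<in> L2"
    by (intro C_J_L2 J L gL unitary_field_prod T inner_function_unitary_field P)
  ultimately show ?thesis by (auto simp: mult_H2_def)
qed


section \<open>From the symbol equation to the conjugation\<close>

text \<open>
  Let \<open>X = \<Psi> \<Lambda>\<^sup>* \<Theta>\<close> and \<open>\<Gamma> = \<Theta> \<Psi>\<^sub>J\<close>.  Then \<open>\<Gamma> \<Lambda>\<^sub>J\<^sup>* = \<Theta> X\<^sub>J \<Theta>\<^sub>J\<^sup>*\<close>, so for \<open>X\<^sub>J = X\<^sup>*\<close> this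
  function equals \<open>\<Theta> \<Theta>\<^sup>* \<Lambda> \<Psi>\<^sup>* \<Theta>\<^sub>J\<^sup>* = \<Lambda> \<Gamma>\<^sub>J\<^sup>*\<close>, which makes \<open>C\<^sub>J\<close> an involution.
\<close>
lemma shift_conjugation_from_inner:
  fixes \<Theta> \<Lambda> \<Psi> :: "complex \<Rightarrow> 'h::findim_chilbert \<Rightarrow> 'h"
  assumes J: "conjugation J" and T: "inner_function \<Theta>" and L: "inner_function \<Lambda>"
    and P: "inner_function \<Psi>"
    and eq: "ae_eq (conj_op J (\<Psi> \<odot> adj_op \<Lambda> \<odot> \<Theta>)) (adj_op (\<Psi> \<odot> adj_op \<Lambda> \<odot> \<Theta>))"
  shows "shift_conjugation_into \<Lambda> \<Theta> (C_J J \<Lambda> (\<Theta> \<odot> conj_op J \<Psi>))"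
proof -
  note UT = inner_function_unitary_field[OF T] and UL = inner_function_unitary_field[OF L]
    and UP = inner_function_unitary_field[OF P]
  note UPJ = unitary_field_conj[OF J UP]
  note UG = unitary_field_prod[OF UT UPJ]
  have "AE z in circle_measure. \<forall>y. (\<Theta> \<odot> conj_op J \<Psi>) z (J (cadjoint (\<Lambda> (cnj z))
      ((\<Theta> \<odot> conj_op J \<Psi>) (cnj z) (J (cadjoint (\<Lambda> z) y))))) = y"
    using eq[unfolded ae_eq_def] unitary_fieldD(3)[OF UT] unitary_fieldD(3)[OF UL] unitary_fieldD(3)[OF UP]
  proof eventually_elim
    case (elim z)
    note T = unitary_opD[OF elim(2)] and L = unitary_opD[OF elim(3)] and P = unitary_opD[OF elim(4)]
    have "J (\<Psi> (cnj z) (cadjoint (\<Lambda> (cnj z)) (\<Theta> (cnj z) (J x)))) =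
        cadjoint (\<Theta> z) (\<Lambda> z (cadjoint (\<Psi> z) x))" for x
      using fun_cong[OF elim(1), of x] T(1) L(1) P(1)
      by (simp add: conj_op_def prod_op_def adj_op_def cadjoint_comp cadjoint_cadjoint
          bounded_clinear_comp bounded_clinear_cadjoint)
    then show ?case
      by (simp add: prod_op_def conj_op_def conjugationD(3)[OF J] T(2,3) L(2,3) P(2,3))
  qed
  then have "L2_conjugation (C_J J \<Lambda> (\<Theta> \<odot> conj_op J \<Psi>))"
    by (rule C_J_conjugation[OF J UL UG])
  then show ?thesis
    unfolding shift_conjugation_into_def
    using C_J_shift[OF J UL UG] C_J_maps_into[OF J UL UT inner_function_conj[OF J P]] by blast
qed


section \<open>The symbol of a conjugation that commutes with the shift\<close>

text \<open>
  For negative powers, apply the case of positive powers to \<open>z\<^sup>n f\<close> and cancel.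
\<close>
lemma shift_commuting_powi:
  assumes C: "L2_conjugation C" and shift: "\<forall>f\<in>L2. ae_eq (C (shift_op f)) (shift_op (C f))"
    and f: "f \<in> L2"
  shows "ae_eq (C (\<lambda>z. z powi n *\<^sub>C f z)) (\<lambda>z. z powi n *\<^sub>C C f z)"
proof -
  have cong: "ae_eq (C g) (C h)" if "g \<in> L2" "h \<in> L2" "ae_eq g h" for g h
    using C that by (simp add: L2_conjugation_def)
  have nat: "ae_eq (C (\<lambda>z. z powi int m *\<^sub>C g z)) (\<lambda>z. z powi int m *\<^sub>C C g z)" if g: "g \<in> L2" for m g
  proof (induction m)
    case 0
    then show ?case by simp
  next
    case (Suc m)
    have eq: "(\<lambda>z. z powi int (Suc m) *\<^sub>C g z) = shift_op (\<lambda>z. z powi int m *\<^sub>C g z)"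
      by (simp add: fun_eq_iff shift_op_def scaleC_scaleC del: of_nat_Suc)
    have "ae_eq (C (\<lambda>z. z powi int (Suc m) *\<^sub>C g z)) (shift_op (C (\<lambda>z. z powi int m *\<^sub>C g z)))"
      unfolding eq using shift L2_powi[OF g] by blast
    also have "ae_eq \<dots> (\<lambda>z. z powi int (Suc m) *\<^sub>C C g z)"
      using Suc unfolding ae_eq_def by eventually_elim (simp add: shift_op_def scaleC_scaleC del: of_nat_Suc)
    finally show ?case .
  qed
  show ?thesis
  proof (cases "n \<ge> 0")
    case True
    then show ?thesis using nat[OF f, of "nat n"] by simp
  next
    case False
    define m where "m = nat (- n)"
    have n: "n = - int m" using False by (simp add: m_def)
    define g where "g z = z powi n *\<^sub>C f z" for z
    have g: "g \<in> L2" unfolding g_def by (rule L2_powi[OF f])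
    have one: "z powi n * z powi int m = 1" if "z \<in> space circle_measure" for z :: complex
      using powi_add_circle[of z n "int m"] that by (simp add: n)
    have "ae_eq f (\<lambda>z. z powi int m *\<^sub>C g z)"
      unfolding ae_eq_def by (rule AE_I2) (metis g_def mult.commute one scaleC_one scaleC_scaleC)
    then have "ae_eq (C f) (C (\<lambda>z. z powi int m *\<^sub>C g z))"
      by (intro cong f L2_powi g)
    also have "ae_eq \<dots> (\<lambda>z. z powi int m *\<^sub>C C g z)" by (rule nat[OF g])
    finally have "AE z in circle_measure. C g z = z powi n *\<^sub>C C f z"
      unfolding ae_eq_def using AE_space
    proof eventually_elim
      case (elim z)
      then show ?case using one[of z] by (simp add: scaleC_scaleC)
    qed
    then show ?thesis by (simp add: ae_eq_def g_def[abs_def])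
  qed
qed

text \<open>
  If \<open>C = C\<^sub>J\<close> with symbol \<open>\<Gamma>\<close>, then \<open>C\<close> maps \<open>\<Lambda> J e\<close> to \<open>\<Gamma> e\<close> for every constant vector \<open>e\<close>;
  so the columns of \<open>\<Gamma>\<close> have to be defined as the functions \<open>\<gamma> e = C (\<Lambda> J e)\<close>.  They lie in
  \<open>\<Theta> H\<^sup>2\<close>, which makes \<open>\<Gamma>\<close> analytic and divisible by \<open>\<Theta>\<close>.  Isometry of \<open>C\<close> and commutation with all
  powers of the shift determine the Fourier coefficients of every function \<open>cinner (C f) (\<gamma> e)\<close>
  (the fact \<open>coeff\<close> in the proof), and uniqueness of Fourier coefficients gives the functions
  themselves: for \<open>f = \<Lambda> J e'\<close> they are constant, so \<open>\<Gamma>\<close> is unitary almost everywhere, and for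
  general \<open>f\<close> they agree with those of \<open>C\<^sub>J f\<close>.  Finally \<open>C\<^sup>2 = 1\<close> is the equation for \<open>\<Gamma>\<close>.
\<close>
theorem shift_conjugation_symbol:
  fixes \<Theta> \<Lambda> :: "complex \<Rightarrow> 'h::findim_chilbert \<Rightarrow> 'h"
  assumes J: "conjugation J" and T: "inner_function \<Theta>" and L: "inner_function \<Lambda>"
    and C: "shift_conjugation_into \<Lambda> \<Theta> C"
  obtains \<Gamma> where "inner_function \<Gamma>" "inner_function (adj_op \<Theta> \<odot> \<Gamma>)"
    "ae_eq (\<Gamma> \<odot> adj_op (conj_op J \<Lambda>)) (\<Lambda> \<odot> adj_op (conj_op J \<Gamma>))"
    "\<And>f. f \<in> L2 \<Longrightarrow> ae_eq (C f) (C_J J \<Lambda> \<Gamma> f)"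
proof -
  note UT = inner_function_unitary_field[OF T] and UL = inner_function_unitary_field[OF L]
  have Cconj: "L2_conjugation C" and Cshift: "\<forall>f\<in>L2. ae_eq (C (shift_op f)) (shift_op (C f))"
    and Cinto: "C ` mult_H2 \<Lambda> \<subseteq> mult_H2 \<Theta>"
    using C by (simp_all add: shift_conjugation_into_def)
  have CL2: "C f \<in> L2" if "f \<in> L2" for f using Cconj that by (simp add: L2_conjugation_def)
  have Cinner: "L2_inner (C f) (C g) = L2_inner g f" if "f \<in> L2" "g \<in> L2" for f g
    using Cconj that by (simp add: L2_conjugation_def)
  define \<gamma> where "\<gamma> e = C (\<lambda>z. \<Lambda> z (J e))" for e
  define \<Gamma> where "\<Gamma> z x = (\<Sum>e\<in>onb. cinner x e *\<^sub>C \<gamma> e z)" for z x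
  have LJ: "(\<lambda>z. \<Lambda> z (J e)) \<in> L2" for e by (rule unitary_field_const_L2[OF UL])
  have \<gamma>L2: "\<gamma> e \<in> L2" for e unfolding \<gamma>_def by (rule CL2[OF LJ])
  have "\<exists>h\<in>H2. ae_eq (\<gamma> e) (mult_op \<Theta> h)" for e
  proof -
    have "(\<lambda>z. \<Lambda> z (J e)) \<in> mult_H2 \<Lambda>"
      using LJ H2_const[of "J e"] by (auto simp: mult_H2_def mult_op_def[abs_def] intro!: bexI[of _ "\<lambda>z. J e"])
    then have "\<gamma> e \<in> mult_H2 \<Theta>" using Cinto by (auto simp: \<gamma>_def)
    then show ?thesis by (simp add: mult_H2_def)
  qed
  then obtain h where h: "\<And>e. h e \<in> H2" "\<And>e. ae_eq (\<gamma> e) (mult_op \<Theta> (h e))" by metis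
  have coeff: "(\<integral>z. z powi n * cinner (C f z) (\<gamma> e z) \<partial>circle_measure) =
      (\<integral>z. z powi (- n) * cinner (\<Lambda> z (J e)) (f z) \<partial>circle_measure)" if f: "f \<in> L2" for n f e
  proof -
    have "(\<integral>z. z powi n * cinner (C f z) (\<gamma> e z) \<partial>circle_measure) = L2_inner (\<lambda>z. z powi n *\<^sub>C C f z) (\<gamma> e)"
      by (simp add: L2_inner_def cinner_scaleC_left)
    also have "\<dots> = L2_inner (C (\<lambda>z. z powi n *\<^sub>C f z)) (\<gamma> e)"
      by (intro L2_inner_cong ae_eq_sym[OF shift_commuting_powi[OF Cconj Cshift f]] L2_powi CL2 f \<gamma>L2) simp
    also have "\<dots> = L2_inner (\<lambda>z. \<Lambda> z (J e)) (\<lambda>z. z powi n *\<^sub>C f z)"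
      unfolding \<gamma>_def by (intro Cinner L2_powi f LJ)
    also have "\<dots> = (\<integral>z. z powi (- n) * cinner (\<Lambda> z (J e)) (f z) \<partial>circle_measure)"
      unfolding L2_inner_def
      by (rule Bochner_Integration.integral_cong[OF refl])
        (simp only: cinner_scaleC_right cnj_powi_circle space_circle)
    finally show ?thesis .
  qed
  have orth: "AE z in circle_measure. cinner (\<gamma> e z) (\<gamma> e' z) = cinner e e'" for e e'
  proof -
    have "AE z in circle_measure. cinner (\<gamma> e z) (\<gamma> e' z) - cinner e e' = 0"
    proof (rule fourier_uniqueness)
      have int: "integrable circle_measure (\<lambda>z. cinner (\<gamma> e z) (\<gamma> e' z))"
        by (rule L2_cinner_integrable[OF \<gamma>L2 \<gamma>L2])
      then show "integrable circle_measure (\<lambda>z. cinner (\<gamma> e z) (\<gamma> e' z) - cinner e e')" by simp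
      fix n
      have "AE z in circle_measure. cinner (\<Lambda> z (J e')) (\<Lambda> z (J e)) = cinner e e'"
        using unitary_fieldD(3)[OF UL]
        by eventually_elim (simp add: unitary_cinner conjugationD(4)[OF J])
      then have "(\<integral>z. z powi (- n) * cinner (\<Lambda> z (J e')) (\<Lambda> z (J e)) \<partial>circle_measure) =
          (\<integral>z. z powi (- n) * cinner e e' \<partial>circle_measure)"
        using LJ[of e] LJ[of e'] by (intro integral_cong_AE) auto
      then have "(\<integral>z. z powi n * cinner (\<gamma> e z) (\<gamma> e' z) \<partial>circle_measure) =
          (\<integral>z. z powi n * cinner e e' \<partial>circle_measure)"
        using coeff[OF LJ, of n e e'] by (simp add: \<gamma>_def integral_powi_circle)
      moreover have "integrable circle_measure (\<lambda>z. z powi n * cinner (\<gamma> e z) (\<gamma> e' z))"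
        by (rule integrable_circle_bounded_mult[OF circle_bounded_powi int])
      ultimately show "(\<integral>z. z powi n * (cinner (\<gamma> e z) (\<gamma> e' z) - cinner e e') \<partial>circle_measure) = 0"
        by (simp add: right_diff_distrib integrable_circle_bounded circle_bounded_powi)
    qed
    then show ?thesis by simp
  qed
  have \<Gamma>_onb: "\<Gamma> z e = \<gamma> e z" if "e \<in> onb" for z e
  proof -
    have "\<Gamma> z e = (\<Sum>f\<in>onb. if f = e then \<gamma> f z else 0)"
      unfolding \<Gamma>_def using that by (intro sum.cong) (auto simp: onb_cinner)
    then show ?thesis using that by simp
  qed
  have \<Gamma>_lin: "bounded_clinear (\<Gamma> z)" for z
    by (rule bounded_clinearI)
      (simp_all add: \<Gamma>_def cinner_add_left cinner_scaleC_left scaleC_add_left sum.distrib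
        scaleC_sum_right scaleC_scaleC)
  have UG: "unitary_field \<Gamma>"
    unfolding unitary_field_def
  proof (intro conjI ballI allI)
    show "(\<lambda>z. \<Gamma> z x) \<in> borel_measurable circle_measure" for x
      unfolding \<Gamma>_def using \<gamma>L2 by measurable
    have "AE z in circle_measure. \<forall>e\<in>onb. \<forall>e'\<in>onb. cinner (\<gamma> e z) (\<gamma> e' z) = cinner e e'"
      by (intro AE_finite_allI finite_onb orth)
    then show "AE z in circle_measure. unitary_op (\<Gamma> z)"
      by eventually_elim (intro unitary_if_isometry \<Gamma>_lin, simp add: \<Gamma>_onb)
  qed (rule \<Gamma>_lin)
  have CCJ: "ae_eq (C f) (C_J J \<Lambda> \<Gamma> f)" if f: "f \<in> L2" for f
  proof -
    note CJL = C_J_L2[OF J UL UG f]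
    have "AE z in circle_measure. cinner (C f z) (\<gamma> e z) = cinner (C_J J \<Lambda> \<Gamma> f z) (\<gamma> e z)"
      if e: "e \<in> onb" for e
    proof -
      have "AE z in circle_measure. cinner (C f z) (\<gamma> e z) - cinner (C_J J \<Lambda> \<Gamma> f z) (\<gamma> e z) = 0"
      proof (rule fourier_uniqueness)
        note int = L2_cinner_integrable[OF CL2[OF f] \<gamma>L2[of e]] L2_cinner_integrable[OF CJL \<gamma>L2[of e]]
        then show "integrable circle_measure (\<lambda>z. cinner (C f z) (\<gamma> e z) - cinner (C_J J \<Lambda> \<Gamma> f z) (\<gamma> e z))"
          by simp
        fix n
        define k where "k z = z powi (- n) * cinner (\<Lambda> z (J e)) (f z)" for z
        have k: "k \<in> borel_measurable circle_measure"
          unfolding k_def using LJ[of e] f by measurable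
        have kc: "(\<lambda>z. k (cnj z)) \<in> borel_measurable circle_measure"
          by (rule measurable_compose[OF measurable_cnj_circle k])
        have "AE z in circle_measure. z powi n * cinner (C_J J \<Lambda> \<Gamma> f z) (\<gamma> e z) = k (cnj z)"
          using unitary_fieldD(3)[OF UG] AE_cnj[OF unitary_fieldD(3)[OF UL]] AE_space
        proof eventually_elim
          case (elim z)
          have "cinner (C_J J \<Lambda> \<Gamma> f z) (\<gamma> e z) = cinner (J (cadjoint (\<Lambda> (cnj z)) (f (cnj z)))) e"
            by (simp add: C_J_apply unitary_cinner[OF elim(1)] flip: \<Gamma>_onb[OF e])
          also have "\<dots> = cinner (\<Lambda> (cnj z) (J e)) (f (cnj z))"
            using conjugation_cinner_swap[OF J, of _ e] cinner_cadjoint[OF unitary_opD(1)[OF elim(2)]]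
            by simp
          finally show ?case
            using cnj_powi_circle[of z "- n"] elim(3) by (simp add: k_def)
        qed
        then have "(\<integral>z. z powi n * cinner (C_J J \<Lambda> \<Gamma> f z) (\<gamma> e z) \<partial>circle_measure) = (\<integral>z. k (cnj z) \<partial>circle_measure)"
          using CJL \<gamma>L2[of e] kc by (intro integral_cong_AE) auto
        also have "\<dots> = (\<integral>z. z powi n * cinner (C f z) (\<gamma> e z) \<partial>circle_measure)"
          using integral_cnj_circle[OF k] coeff[OF f, of n e] by (simp add: k_def)
        finally show "(\<integral>z. z powi n * (cinner (C f z) (\<gamma> e z) - cinner (C_J J \<Lambda> \<Gamma> f z) (\<gamma> e z)) \<partial>circle_measure) = 0"
          by (simp add: right_diff_distrib integrable_circle_bounded_mult[OF circle_bounded_powi] int)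
      qed
      then show ?thesis by simp
    qed
    then have "AE z in circle_measure. \<forall>e\<in>onb. cinner (C f z) (\<gamma> e z) = cinner (C_J J \<Lambda> \<Gamma> f z) (\<gamma> e z)"
      by (intro AE_finite_allI finite_onb)
    then show ?thesis
      unfolding ae_eq_def using unitary_fieldD(3)[OF UG]
    proof eventually_elim
      case (elim z)
      have "cadjoint (\<Gamma> z) (C f z) = cadjoint (\<Gamma> z) (C_J J \<Lambda> \<Gamma> f z)"
        by (rule onb_eqI) (use elim(1) in \<open>simp add: cinner_cadjoint_left[OF \<Gamma>_lin] \<Gamma>_onb\<close>)
      then show ?case by (metis unitary_opD(3)[OF elim(2)])
    qed
  qed
  have \<gamma>H2: "\<gamma> e \<in> H2" for e
    using H2_ae_eq[OF inner_mult_H2[OF T h(1)] L2_measurable[OF \<gamma>L2] ae_eq_sym[OF h(2)]] .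
  have IG: "inner_function \<Gamma>"
    unfolding inner_function_iff using UG
    by (auto simp: \<Gamma>_def intro!: H2_sum H2_scaleC \<gamma>H2)
  have "inner_function (adj_op \<Theta> \<odot> \<Gamma>)"
    unfolding inner_function_iff
  proof (intro conjI allI)
    show U: "unitary_field (adj_op \<Theta> \<odot> \<Gamma>)" by (intro unitary_field_prod unitary_field_adj UT UG)
    fix x
    have "AE z in circle_measure. \<forall>e\<in>onb. \<gamma> e z = mult_op \<Theta> (h e) z"
      using h(2) by (intro AE_finite_allI finite_onb) (simp add: ae_eq_def)
    then have "ae_eq (\<lambda>z. \<Sum>e\<in>onb. cinner x e *\<^sub>C h e z) (\<lambda>z. (adj_op \<Theta> \<odot> \<Gamma>) z x)"
      unfolding ae_eq_def using unitary_fieldD(3)[OF UT]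
    proof eventually_elim
      case (elim z)
      note T = unitary_opD[OF elim(2)]
      have "(adj_op \<Theta> \<odot> \<Gamma>) z x = (\<Sum>e\<in>onb. cinner x e *\<^sub>C cadjoint (\<Theta> z) (\<gamma> e z))"
        by (simp add: prod_op_def adj_op_def \<Gamma>_def bounded_clinear_simps[OF bounded_clinear_cadjoint[OF T(1)]])
      also have "\<dots> = (\<Sum>e\<in>onb. cinner x e *\<^sub>C h e z)"
        using elim(1) by (intro sum.cong) (simp_all add: mult_op_def T)
      finally show ?case ..
    qed
    moreover have "(\<lambda>z. \<Sum>e\<in>onb. cinner x e *\<^sub>C h e z) \<in> H2" by (intro H2_sum H2_scaleC h)
    ultimately show "(\<lambda>z. (adj_op \<Theta> \<odot> \<Gamma>) z x) \<in> H2"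
      using H2_ae_eq unitary_fieldD(2)[OF U] by blast
  qed
  moreover have "ae_eq (\<Gamma> \<odot> adj_op (conj_op J \<Lambda>)) (\<Lambda> \<odot> adj_op (conj_op J \<Gamma>))"
    unfolding symbol_equation_iff[OF J UL UG]
  proof -
    have "ae_eq (C_J J \<Lambda> \<Gamma> (C_J J \<Lambda> \<Gamma> (\<lambda>z. e))) (\<lambda>z. e)" for e
    proof -
      have e: "(\<lambda>z. e) \<in> L2" by (rule L2_const)
      have "ae_eq (C_J J \<Lambda> \<Gamma> (C_J J \<Lambda> \<Gamma> (\<lambda>z. e))) (C_J J \<Lambda> \<Gamma> (C (\<lambda>z. e)))"
        by (intro C_J_cong ae_eq_sym[OF CCJ] e)
      also have "ae_eq \<dots> (C (C (\<lambda>z. e)))" by (intro ae_eq_sym[OF CCJ] CL2 e)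
      also have "ae_eq \<dots> (\<lambda>z. e)" using Cconj e by (simp add: L2_conjugation_def)
      finally show ?thesis .
    qed
    then have "AE z in circle_measure. \<forall>e\<in>onb. C_J J \<Lambda> \<Gamma> (C_J J \<Lambda> \<Gamma> (\<lambda>z. e)) z = e"
      by (intro AE_finite_allI finite_onb) (simp add: ae_eq_def)
    then show "AE z in circle_measure.
        \<forall>y. \<Gamma> z (J (cadjoint (\<Lambda> (cnj z)) (\<Gamma> (cnj z) (J (cadjoint (\<Lambda> z) y))))) = y"
      using unitary_fieldD(3)[OF UL] AE_cnj[OF unitary_fieldD(3)[OF UL]]
    proof eventually_elim
      case (elim z)
      have "\<Gamma> z \<circ> (J \<circ> (cadjoint (\<Lambda> (cnj z)) \<circ> \<Gamma> (cnj z)) \<circ> J) \<circ> cadjoint (\<Lambda> z) = id"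
      proof (rule bounded_clinear_ext)
        fix e :: 'h assume "e \<in> onb"
        then show "(\<Gamma> z \<circ> (J \<circ> (cadjoint (\<Lambda> (cnj z)) \<circ> \<Gamma> (cnj z)) \<circ> J) \<circ> cadjoint (\<Lambda> z)) e = id e"
          using elim(1) by (simp add: C_J_apply)
      qed (intro bounded_clinear_comp bounded_clinear_conj J bounded_clinear_cadjoint \<Gamma>_lin
          unitary_opD(1)[OF elim(2)] unitary_opD(1)[OF elim(3)] bounded_clinear_id)+
      then show ?case by (simp add: fun_eq_iff)
    qed
  qed
  ultimately show thesis using that[OF IG] CCJ by blast
qed

text \<open>
  The choice of \<open>\<Psi>\<close> is forced by \<open>\<Gamma> = \<Theta> \<Psi>\<^sub>J\<close>.  With it \<open>(\<Psi> \<Lambda>\<^sup>* \<Theta>)\<^sub>J = \<Theta>\<^sup>* (\<Gamma> \<Lambda>\<^sub>J\<^sup>*) \<Theta>\<^sub>J\<close> and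
  \<open>(\<Psi> \<Lambda>\<^sup>* \<Theta>)\<^sup>* = \<Theta>\<^sup>* (\<Lambda> \<Gamma>\<^sub>J\<^sup>*) \<Theta>\<^sub>J\<close>.
\<close>
lemma conj_eq_adj_from_symbol:
  fixes \<Theta> \<Lambda> \<Gamma> :: "complex \<Rightarrow> 'h::findim_chilbert \<Rightarrow> 'h"
  assumes J: "conjugation J" and T: "unitary_field \<Theta>" and L: "unitary_field \<Lambda>" and G: "unitary_field \<Gamma>"
    and eq: "ae_eq (\<Gamma> \<odot> adj_op (conj_op J \<Lambda>)) (\<Lambda> \<odot> adj_op (conj_op J \<Gamma>))"
  defines "\<Psi> \<equiv> conj_op J (adj_op \<Theta> \<odot> \<Gamma>)"
  shows "ae_eq (conj_op J (\<Psi> \<odot> adj_op \<Lambda> \<odot> \<Theta>)) (adj_op (\<Psi> \<odot> adj_op \<Lambda> \<odot> \<Theta>))"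
  unfolding ae_eq_def
  using eq[unfolded ae_eq_def] unitary_fieldD(3)[OF T] unitary_fieldD(3)[OF L] unitary_fieldD(3)[OF G]
    AE_cnj[OF unitary_fieldD(3)[OF T]] AE_cnj[OF unitary_fieldD(3)[OF L]] AE_cnj[OF unitary_fieldD(3)[OF G]]
proof eventually_elim
  case (elim z)
  note lin = elim(2-7)[THEN unitary_opD(1)]
  note bc = lin bounded_clinear_comp bounded_clinear_cadjoint bounded_clinear_conj[OF J]
  have eq: "\<Gamma> z (J (cadjoint (\<Lambda> (cnj z)) (J x))) = \<Lambda> z (J (cadjoint (\<Gamma> (cnj z)) (J x)))" for x
    using fun_cong[OF elim(1), of x]
    by (simp add: prod_op_def adj_op_def conj_op_def cadjoint_conj[OF J] bc)
  have \<Psi>z: "cadjoint (\<Psi> z) = J \<circ> (cadjoint (\<Gamma> (cnj z)) \<circ> \<Theta> (cnj z)) \<circ> J"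
    by (simp add: \<Psi>_def conj_op_def prod_op_def adj_op_def cadjoint_conj[OF J] cadjoint_comp
        cadjoint_cadjoint bc)
  have \<Psi>lin: "bounded_clinear (\<Psi> z)"
    by (simp add: \<Psi>_def conj_op_def prod_op_def adj_op_def bc)
  show ?case
  proof
    fix x
    have "conj_op J (\<Psi> \<odot> adj_op \<Lambda> \<odot> \<Theta>) z x =
        cadjoint (\<Theta> z) (\<Gamma> z (J (cadjoint (\<Lambda> (cnj z)) (\<Theta> (cnj z) (J x)))))"
      by (simp add: \<Psi>_def conj_op_def prod_op_def adj_op_def conjugationD(3)[OF J])
    also have "\<dots> = cadjoint (\<Theta> z) (\<Lambda> z (J (cadjoint (\<Gamma> (cnj z)) (\<Theta> (cnj z) (J x)))))"
      using eq[of "J (\<Theta> (cnj z) (J x))"] by (simp add: conjugationD(3)[OF J])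
    also have "\<dots> = adj_op (\<Psi> \<odot> adj_op \<Lambda> \<odot> \<Theta>) z x"
      by (simp add: prod_op_def adj_op_def cadjoint_comp cadjoint_cadjoint bc \<Psi>lin \<Psi>z)
    finally show "conj_op J (\<Psi> \<odot> adj_op \<Lambda> \<odot> \<Theta>) z x = adj_op (\<Psi> \<odot> adj_op \<Lambda> \<odot> \<Theta>) z x" .
  qed
qed

section \<open>The characterisation\<close>

theorem theorem8p6:
  fixes \<Theta> \<Lambda> :: "complex \<Rightarrow> 'h::findim_chilbert \<Rightarrow> 'h" and J :: "'h \<Rightarrow> 'h"
  assumes "inner_function \<Theta>" and "inner_function \<Lambda>" and "conjugation J"
  shows "((\<exists>C. shift_conjugation_into \<Lambda> \<Theta> C) \<longleftrightarrow>
          (\<exists>\<Psi>. inner_function \<Psi> \<and>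
               ae_eq (conj_op J (\<Psi> \<odot> adj_op \<Lambda> \<odot> \<Theta>)) (adj_op (\<Psi> \<odot> adj_op \<Lambda> \<odot> \<Theta>)))) \<and>
         (\<forall>C. shift_conjugation_into \<Lambda> \<Theta> C \<longrightarrow>
            (\<exists>\<Gamma>. inner_function \<Gamma> \<and> inner_le \<Theta> \<Gamma> \<and>
                 ae_eq (\<Gamma> \<odot> adj_op (conj_op J \<Lambda>)) (\<Lambda> \<odot> adj_op (conj_op J \<Gamma>)) \<and>
                 (\<forall>f\<in>L2. ae_eq (C f) (C_J J \<Lambda> \<Gamma> f))))"
proof (intro conjI iffI allI impI)
  note symbol = shift_conjugation_symbol[OF assms(3,1,2)]
  {
    assume "\<exists>C. shift_conjugation_into \<Lambda> \<Theta> C"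
    then obtain C \<Gamma> where \<Gamma>: "inner_function \<Gamma>" "inner_function (adj_op \<Theta> \<odot> \<Gamma>)"
      "ae_eq (\<Gamma> \<odot> adj_op (conj_op J \<Lambda>)) (\<Lambda> \<odot> adj_op (conj_op J \<Gamma>))"
      using symbol by metis
    show "\<exists>\<Psi>. inner_function \<Psi> \<and>
        ae_eq (conj_op J (\<Psi> \<odot> adj_op \<Lambda> \<odot> \<Theta>)) (adj_op (\<Psi> \<odot> adj_op \<Lambda> \<odot> \<Theta>))"
      using inner_function_conj[OF assms(3) \<Gamma>(2)]
        conj_eq_adj_from_symbol[OF assms(3) assms(1,2)[THEN inner_function_unitary_field]
          inner_function_unitary_field[OF \<Gamma>(1)] \<Gamma>(3)] by blast
  next
    assume "\<exists>\<Psi>. inner_function \<Psi> \<and>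
        ae_eq (conj_op J (\<Psi> \<odot> adj_op \<Lambda> \<odot> \<Theta>)) (adj_op (\<Psi> \<odot> adj_op \<Lambda> \<odot> \<Theta>))"
    then show "\<exists>C. shift_conjugation_into \<Lambda> \<Theta> C"
      using shift_conjugation_from_inner[OF assms(3,1,2)] by blast
  next
    fix C assume "shift_conjugation_into \<Lambda> \<Theta> C"
    then obtain \<Gamma> where \<Gamma>: "inner_function \<Gamma>" "inner_function (adj_op \<Theta> \<odot> \<Gamma>)"
      "ae_eq (\<Gamma> \<odot> adj_op (conj_op J \<Lambda>)) (\<Lambda> \<odot> adj_op (conj_op J \<Gamma>))"
      "\<And>f. f \<in> L2 \<Longrightarrow> ae_eq (C f) (C_J J \<Lambda> \<Gamma> f)"
      by (rule symbol) blast
    moreover have "inner_le \<Theta> \<Gamma>" using \<Gamma>(2) by (simp add: inner_le_def inner_function_def)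
    ultimately show "\<exists>\<Gamma>. inner_function \<Gamma> \<and> inner_le \<Theta> \<Gamma> \<and>
        ae_eq (\<Gamma> \<odot> adj_op (conj_op J \<Lambda>)) (\<Lambda> \<odot> adj_op (conj_op J \<Gamma>)) \<and>
        (\<forall>f\<in>L2. ae_eq (C f) (C_J J \<Lambda> \<Gamma> f))" by blast
  }
qed

end
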